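(* Let $v,\lambda,\mu>0$, $p\in(0,1]$ and $\rho=\frac{p\lambda}{\mu}$. Suppose $\rho<1$. For an agent following the random waypoint trajectory under M/M/1 queuing (waypoint intervals $Y_j$ i.i.d. exponential with rate $\lambda$, service times i.i.d. exponential with rate $\mu$, each waypoint update polled independently with probability $p$, first-come-first-served single server in steady state), the Age of Positioning is ${\rm AoP}=p\,\kappa\,\lambda\,\mathbb{E}[Q_i]$, where $$\mathbb{E}[Q_i]= 2 v^2 \frac{1-p}{p^2 \lambda^3} + \frac{2v^2}{p\lambda^3} + \frac{2v^2}{p\lambda^2\mu} + \frac{2v^2 p \rho_e}{\mu(1-\rho)}\cdot\frac{1}{(\mu(1-\rho)+\lambda)^2\,(1-\rho_e(1-p))^2},$$ with $\rho_e=\frac{\lambda}{\mu(1-\rho)+\lambda}$.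
   Context: An agent moves in the plane in successive hops with constant speed $v$; at the end of each hop (a waypoint) it picks a new direction uniformly in $(0,2\pi]$, independently. Waypoints are generated by an arrival process of rate $\lambda$. At each waypoint a position update is generated and, independently of everything else, is transmitted ("polled") with probability $p$ and otherwise discarded. Polled updates enter a single-server first-come-first-served queue with service rate $\mu$ and become available at the central server on departure. Service times are independent of the arrival and polling processes. In the notation A/B/1, A refers to the waypoint generation process before polling and B to the service process. Let $X_i$ be the time between the $(i-1)$-th and the $i$-th polled updates. Then $X_i=\sum_{j=1}^{k}Y_j$, where $Y_1,\dots,Y_k$ are the durations of the successive hops between these two polled updates and $k$ is the number of such hops, geometric with $\Pr(k=n)=p(1-p)^{n-1}$, $n\ge 1$, independent of the $Y_j$. For M arrivals the $Y_j$ are i.i.d. exponential with rate $\lambda$. Let $S_i$ be the service time of the $i$-th polled update (for M service: exponential with rate $\mu$) and let $T_i=W_i+S_i$ be its total time in the system, with waiting time $W_i=(T_{i-1}-X_i)^+$. The queue is in steady state, so $T_{i-1}$ has the stationary system-time distribution and is independent of $X_i$ and its hop durations. The position error bound of the position estimate computed from the last available update, after hops of durations $\delta_1,\dots,\delta_h$ since that update was generated, is ${\rm PEB}={\rm PEB}_{\rm o}+\kappa\sum_{l=1}^{h}v^2\delta_l^2$, where ${\rm PEB}_{\rm o}$ is the bound at the instant the update was generated; $\kappa=1$ in the motion agnostic mode and $\kappa=\epsilon^2/3$ in the dead-reckoning aided mode (direction sensor errors uniform on $(-\epsilon,\epsilon)$, $\epsilon$ small). The Age of Positioning (AoP) is the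 long-run time average of ${\rm PEB}(t)-{\rm PEB}_{\rm o}$; it is expressed as (and may be taken here to be defined by) $${\rm AoP}=p\,\kappa\,\lambda\,\mathbb{E}[Q_i],\qquad Q_i=G_1+G_2+G_3,$$ $$G_1=\sum_{j=1}^{k}\frac{v^2}{3}Y_j^3,\qquad G_2=\sum_{j=1}^{k}Y_j\Big(\sum_{l=1}^{j-1}v^2Y_l^2\Big),\qquad G_3=H_iT_i,\qquad H_i=\sum_{j=1}^{k}v^2Y_j^2 .$$ *)

theory Defs
  imports "HOL-Probability.Probability"
begin

text \<open>
  Time starts at a polled waypoint, which is waypoint 0 and polled update 0. For \<open>n \<ge> 1\<close>,
  \<open>hop n\<close> is the duration of the hop that ends at waypoint \<open>n\<close>, and \<open>polled n\<close> tells whether the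
  update generated at waypoint \<open>n\<close> is transmitted. For \<open>i \<ge> 1\<close>, \<open>service i\<close> is the service time of
  the \<open>i\<close>-th polled update. \<open>initial_time\<close> is the total time in the system of polled update 0; it
  carries the state of the queue at time 0. The entries \<open>hop 0\<close>, \<open>polled 0\<close> and \<open>service 0\<close> are
  never used.
\<close>

record 'a waypoint_queue =
  hop :: "nat \<Rightarrow> 'a \<Rightarrow> real"
  polled :: "nat \<Rightarrow> 'a \<Rightarrow> bool"
  service :: "nat \<Rightarrow> 'a \<Rightarrow> real"
  initial_time :: "'a \<Rightarrow> real"

text \<open>
  Index of the waypoint at which the \<open>i\<close>-th polled update is generated. When infinitely many
  updates are polled (almost surely the case below), the \<open>LEAST\<close> is attained.
\<close>

primrec polled_index :: "'a waypoint_queue \<Rightarrow> nat \<Rightarrow> 'a \<Rightarrow> nat" where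
  "polled_index R 0 \<omega> = 0"
| "polled_index R (Suc i) \<omega> = (LEAST n. n > polled_index R i \<omega> \<and> polled R n \<omega>)"

text \<open>
  The quantities below that carry an index \<open>i\<close> refer to the interval between the polled updates
  \<open>i - 1\<close> and \<open>i\<close>, and are meant for \<open>i \<ge> 1\<close>: \<open>hop_count\<close> is \<open>k\<close>, \<open>hop_duration R i j\<close> is \<open>Y\<^sub>j\<close> for
  \<open>1 \<le> j \<le> k\<close>, and \<open>interarrival\<close> is \<open>X\<^sub>i\<close>.
\<close>

definition hop_count :: "'a waypoint_queue \<Rightarrow> nat \<Rightarrow> 'a \<Rightarrow> nat" where
  "hop_count R i \<omega> = polled_index R i \<omega> - polled_index R (i - 1) \<omega>"

definition hop_duration :: "'a waypoint_queue \<Rightarrow> nat \<Rightarrow> nat \<Rightarrow> 'a \<Rightarrow> real" where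
  "hop_duration R i j \<omega> = hop R (polled_index R (i - 1) \<omega> + j) \<omega>"

definition interarrival :: "'a waypoint_queue \<Rightarrow> nat \<Rightarrow> 'a \<Rightarrow> real" where
  "interarrival R i \<omega> = (\<Sum>j=1..hop_count R i \<omega>. hop_duration R i j \<omega>)"

text \<open>
  \<open>T\<^sub>i = W\<^sub>i + S\<^sub>i\<close> with first-come-first-served waiting time \<open>W\<^sub>i = (T\<^bsub>i-1\<^esub> - X\<^sub>i)\<^sup>+\<close>.
\<close>

primrec system_time :: "'a waypoint_queue \<Rightarrow> nat \<Rightarrow> 'a \<Rightarrow> real" where
  "system_time R 0 \<omega> = initial_time R \<omega>"
| "system_time R (Suc i) \<omega> =
     max 0 (system_time R i \<omega> - interarrival R (Suc i) \<omega>) + service R (Suc i) \<omega>"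

text \<open>
  Joint independence of all sources of randomness is expressed by a single real-valued family;
  the polling decisions enter through their 0/1 indicators.
\<close>

datatype source = Init | Hop nat | Poll nat | Serv nat

primrec source_var :: "'a waypoint_queue \<Rightarrow> source \<Rightarrow> 'a \<Rightarrow> real" where
  "source_var R Init = initial_time R"
| "source_var R (Hop n) = hop R n"
| "source_var R (Poll n) = (\<lambda>\<omega>. of_bool (polled R n \<omega>))"
| "source_var R (Serv i) = service R i"

definition MM1_waypoint_queue ::
  "'a measure \<Rightarrow> real \<Rightarrow> real \<Rightarrow> real \<Rightarrow> 'a waypoint_queue \<Rightarrow> bool" where
  "MM1_waypoint_queue M lam \<mu> p R \<longleftrightarrow>
     prob_space M \<and>
     prob_space.indep_vars M (\<lambda>_. borel) (source_var R) (UNIV - {Hop 0, Poll 0, Serv 0}) \<and>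
     (\<forall>n\<ge>1. distributed M lborel (hop R n) (exponential_density lam)) \<and>
     (\<forall>n\<ge>1. measure M {\<omega> \<in> space M. polled R n \<omega>} = p) \<and>
     (\<forall>i\<ge>1. distributed M lborel (service R i) (exponential_density \<mu>))"

text \<open>
  The law of the system time is invariant under the queue dynamics. Together with the independence
  of \<open>initial_time\<close> from the other sources, this says that the queue is started in equilibrium.
\<close>

definition steady_state :: "'a measure \<Rightarrow> 'a waypoint_queue \<Rightarrow> bool" where
  "steady_state M R \<longleftrightarrow>
     (\<forall>i. distr M borel (system_time R i) = distr M borel (system_time R 0))"

definition G1 :: "'a waypoint_queue \<Rightarrow> real \<Rightarrow> nat \<Rightarrow> 'a \<Rightarrow> real" where
  "G1 R v i \<omega> = (\<Sum>j=1..hop_count R i \<omega>. v\<^sup>2 / 3 * hop_duration R i j \<omega> ^ 3)"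

definition G2 :: "'a waypoint_queue \<Rightarrow> real \<Rightarrow> nat \<Rightarrow> 'a \<Rightarrow> real" where
  "G2 R v i \<omega> = (\<Sum>j=1..hop_count R i \<omega>.
     hop_duration R i j \<omega> * (\<Sum>l=1..j - 1. v\<^sup>2 * (hop_duration R i l \<omega>)\<^sup>2))"

definition H :: "'a waypoint_queue \<Rightarrow> real \<Rightarrow> nat \<Rightarrow> 'a \<Rightarrow> real" where
  "H R v i \<omega> = (\<Sum>j=1..hop_count R i \<omega>. v\<^sup>2 * (hop_duration R i j \<omega>)\<^sup>2)"

definition G3 :: "'a waypoint_queue \<Rightarrow> real \<Rightarrow> nat \<Rightarrow> 'a \<Rightarrow> real" where
  "G3 R v i \<omega> = H R v i \<omega> * system_time R i \<omega>"

definition Q :: "'a waypoint_queue \<Rightarrow> real \<Rightarrow> nat \<Rightarrow> 'a \<Rightarrow> real" where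
  "Q R v i \<omega> = G1 R v i \<omega> + G2 R v i \<omega> + G3 R v i \<omega>"

text \<open>
  \<open>Dead_Reckoning \<epsilon>\<close> is the mode with direction sensor errors uniform on \<open>(-\<epsilon>, \<epsilon>)\<close>.
\<close>

datatype positioning_mode = Motion_Agnostic | Dead_Reckoning real

primrec kappa :: "positioning_mode \<Rightarrow> real" where
  "kappa Motion_Agnostic = 1"
| "kappa (Dead_Reckoning \<epsilon>) = \<epsilon>\<^sup>2 / 3"

text \<open>
  The long-run time average of the excess position error bound is taken in its renewal-reward form:
  the rate \<open>p * lam\<close> of polled updates times the mean contribution \<open>kappa mode * Q\<^sub>i\<close> of one of them.
\<close>

definition AoP ::
  "'a measure \<Rightarrow> 'a waypoint_queue \<Rightarrow> real \<Rightarrow> real \<Rightarrow> real \<Rightarrow> positioning_mode \<Rightarrow> nat \<Rightarrow> real" where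
  "AoP M R v lam p mode i = p * kappa mode * lam * (\<integral>\<omega>. Q R v i \<omega> \<partial>M)"

end

theory Submission
  imports Defs
begin

text \<open>
  A polled waypoint is a regeneration time of the hop, polling and service sequences, so in
  equilibrium the law of \<open>Q\<^sub>i\<close> does not depend on \<open>i\<close>, and only the first polling interval has to be
  computed. Its length \<open>X\<^sub>1\<close> is a geometric sum of exponentials, hence exponential with rate
  \<open>p\<lambda>\<close>; stationarity turns the characteristic function of \<open>T\<^sub>0\<close> into the solution of a linear
  equation, and \<open>T\<^sub>0\<close> is exponential with rate \<open>\<theta> = \<mu> - p\<lambda> = \<mu>(1 - \<rho>)\<close>. Given \<open>k = n\<close> hops,
  \<open>E (T\<^sub>0 - x)\<^sup>+ = e\<^bsup>-\<theta>x\<^esup> / \<theta>\<close> makes the waiting part of \<open>G\<^sub>3\<close> a sum of products over independent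
  hops, and the four terms of the formula are the resulting series in \<open>(1 - p)\<^sup>n\<close> and
  \<open>(\<rho>\<^sub>e (1 - p))\<^sup>n\<close>.
\<close>

section \<open>Series and independence\<close>

text \<open>At the outset nothing but invariance in law is known about \<open>initial_time\<close>:
  no density, no moment, no sign. Its law is therefore recovered through a bounded transform and
  uniqueness of characteristic functions, and its sign from that of the next system time. The
  obstacle to regeneration is that the i-th polled waypoint has a random index and that
  \<open>LEAST\<close> inspects polls without bound. Paths are split by the value m of
  \<open>polled_index\<close>; on each piece the past is rewritten as a function of finitely many
  sources, disjoint from the sources shifted by m. The renewal argument and the conditioning on k
  use nonnegative integrals, so that splitting and interchange need no integrability; integrability
  of \<open>Q\<close> falls out at the end, from the finite value. \<open>G3\<close> does not
  factor, because the waiting time contains the very hops whose squares it multiplies. Integrating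
  out the initial time gives each hop Y a weight \<open>exp (- \<theta> * Y)\<close>. Hence
  \<open>\<rho>\<^sub>e = lam / (lam + \<theta>)\<close> is the Laplace transform of a hop at
  \<theta>, and the hop carrying the square contributes
  \<open>2 * lam / (lam + \<theta>) ^ 3\<close>.\<close>

lemma suminf_of_bool_eq:
  fixes f :: "nat \<Rightarrow> ennreal"
  shows "(\<Sum>m. of_bool (N = m) * f m) = f N"
proof -
  have "(\<Sum>m. of_bool (N = m) * f m) = (\<Sum>m\<in>{N}. of_bool (N = m) * f m)"
    by (rule suminf_finite) auto
  then show ?thesis by simp
qed

text \<open>The coefficient (n+1)n/2 counts the pairs l < j among n+1 hops, as needed for
  \<open>G2\<close>. Termwise differentiation of the series for 1/(1-z)^2 gives coefficients
  (n+1)(n+2); subtracting twice the original series turns n+2 into n.\<close>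

lemma geometric_second_deriv_sums:
  fixes z :: real
  assumes "\<bar>z\<bar> < 1"
  shows "(\<lambda>n. real (Suc n) * real n / 2 * z ^ n) sums (z / (1 - z) ^ 3)"
proof -
  have "(\<lambda>n. diffs (\<lambda>n. real (Suc n)) n * z ^ n) sums (2 / (1 - z) ^ 3)"
  proof (rule termdiffs_sums_strong[where K = 1 and f = "\<lambda>z. 1 / (1 - z) ^ 2"])
    show "(\<lambda>n. real (Suc n) * w ^ n) sums (1 / (1 - w)\<^sup>2)" if "norm w < 1" for w :: real
      using geometric_deriv_sums[OF that] by simp
    have w: "1 - z \<noteq> 0" using assms by auto
    have "((\<lambda>z. 1 / (1 - z)\<^sup>2) has_field_derivative (2 * (1 - z) / ((1 - z)\<^sup>2 * (1 - z)\<^sup>2))) (at z)"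
      using w by (auto intro!: derivative_eq_intros)
    also have "2 * (1 - z) / ((1 - z)\<^sup>2 * (1 - z)\<^sup>2) = 2 / (1 - z) ^ 3"
    proof -
      have "2 * w / (w\<^sup>2 * w\<^sup>2) = 2 / w ^ 3" if "w \<noteq> 0" for w :: real
        using that by (simp add: field_simps power2_eq_square power3_eq_cube)
      then show ?thesis using w by blast
    qed
    finally show "((\<lambda>z. 1 / (1 - z)\<^sup>2) has_field_derivative 2 / (1 - z) ^ 3) (at z)" .
  qed (use assms in simp)
  from sums_mult[OF sums_diff[OF this sums_mult[OF geometric_deriv_sums[of z], of 2]], of "1 / 2"]
  have "(\<lambda>n. 1 / 2 * (diffs (\<lambda>n. real (Suc n)) n * z ^ n - 2 * (real (Suc n) * z ^ n)))
      sums (1 / 2 * (2 / (1 - z) ^ 3 - 2 * (1 / (1 - z)\<^sup>2)))"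
    using assms by simp
  moreover have "1 / 2 * (diffs (\<lambda>n. real (Suc n)) n * z ^ n - 2 * (real (Suc n) * z ^ n))
      = real (Suc n) * real n / 2 * z ^ n" for n
    by (simp add: diffs_def algebra_simps)
  moreover have "1 / 2 * (2 / (1 - z) ^ 3 - 2 * (1 / (1 - z)\<^sup>2)) = z / (1 - z) ^ 3"
  proof -
    have "1 / 2 * (2 / w ^ 3 - 2 * (1 / w\<^sup>2)) = (1 - w) / w ^ 3" if "w \<noteq> 0" for w :: real
      using that by (simp add: field_simps power2_eq_square power3_eq_cube)
    from this[of "1 - z"] show ?thesis using assms by auto
  qed
  ultimately show ?thesis by (simp only:)
qed

text \<open>Injectivity makes the singletons {f j} disjoint, so the renamed family is a grouping of
  the old one into one-element blocks.\<close>

lemma (in prob_space) indep_vars_reindex_inj: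
  assumes "indep_vars N X I" and f: "inj_on f J" "f ` J \<subseteq> I"
  shows "indep_vars (\<lambda>j. N (f j)) (\<lambda>j. X (f j)) J"
proof -
  have "indep_vars (\<lambda>j. PiM {f j} N) (\<lambda>j \<omega>. restrict (\<lambda>i. X i \<omega>) {f j}) J"
    by (rule indep_vars_restrict[OF assms(1)])
      (use f in \<open>auto simp: disjoint_family_on_def inj_on_def\<close>)
  then have "indep_vars (\<lambda>j. N (f j)) (\<lambda>j \<omega>. (restrict (\<lambda>i. X i \<omega>) {f j}) (f j)) J"
    by (rule indep_vars_compose2) simp
  then show ?thesis by simp
qed

text \<open>Tonelli for the joint law, with both integrals pulled back to \<open>M\<close>:
  \<omega>' acts as an independent copy of the sample point, at which Y is frozen while X is
  averaged.\<close>

lemma (in prob_space) nn_integral_indep_var: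
  assumes "indep_var S X T Y" and f: "f \<in> borel_measurable (S \<Otimes>\<^sub>M T)"
  shows "(\<integral>\<^sup>+\<omega>. f (X \<omega>, Y \<omega>) \<partial>M) = (\<integral>\<^sup>+\<omega>'. (\<integral>\<^sup>+\<omega>. f (X \<omega>, Y \<omega>') \<partial>M) \<partial>M)"
proof -
  note [measurable] = f
  have X[measurable]: "X \<in> measurable M S" and Y[measurable]: "Y \<in> measurable M T"
    and D: "distr M S X \<Otimes>\<^sub>M distr M T Y = distr M (S \<Otimes>\<^sub>M T) (\<lambda>\<omega>. (X \<omega>, Y \<omega>))"
    using assms(1) by (simp_all add: indep_var_distribution_eq)
  interpret X: prob_space "distr M S X" by (rule prob_space_distr) fact
  interpret Y: prob_space "distr M T Y" by (rule prob_space_distr) fact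
  interpret pair_sigma_finite "distr M S X" "distr M T Y" ..
  have "(\<integral>\<^sup>+\<omega>. f (X \<omega>, Y \<omega>) \<partial>M) = integral\<^sup>N (distr M S X \<Otimes>\<^sub>M distr M T Y) f"
    unfolding D by (simp add: nn_integral_distr)
  also have "\<dots> = (\<integral>\<^sup>+y. (\<integral>\<^sup>+x. f (x, y) \<partial>distr M S X) \<partial>distr M T Y)"
    by (rule nn_integral_snd[symmetric]) simp
  also have "\<dots> = (\<integral>\<^sup>+y. (\<integral>\<^sup>+\<omega>. f (X \<omega>, y) \<partial>M) \<partial>distr M T Y)"
    by (intro nn_integral_cong, subst nn_integral_distr) auto
  also have "\<dots> = (\<integral>\<^sup>+\<omega>'. (\<integral>\<^sup>+\<omega>. f (X \<omega>, Y \<omega>') \<partial>M) \<partial>M)"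
    by (subst nn_integral_distr) auto
  finally show ?thesis .
qed

text \<open>The inner integral stays on the law of Y because in the application that law is a known
  exponential measure; values in a Banach space admit the complex exponentials.\<close>

lemma (in prob_space) integral_indep_var:
  fixes f :: "_ \<Rightarrow> 'b::{banach, second_countable_topology}"
  assumes "indep_var S X T Y" and f: "f \<in> borel_measurable (S \<Otimes>\<^sub>M T)"
    and int: "integrable M (\<lambda>\<omega>. f (X \<omega>, Y \<omega>))"
  shows "(\<integral>\<omega>. f (X \<omega>, Y \<omega>) \<partial>M) = (\<integral>\<omega>. (\<integral>y. f (X \<omega>, y) \<partial>distr M T Y) \<partial>M)"
proof -
  note [measurable] = f
  have X[measurable]: "X \<in> measurable M S" and Y[measurable]: "Y \<in> measurable M T"
    and D: "distr M S X \<Otimes>\<^sub>M distr M T Y = distr M (S \<Otimes>\<^sub>M T) (\<lambda>\<omega>. (X \<omega>, Y \<omega>))"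
    using assms(1) by (simp_all add: indep_var_distribution_eq)
  interpret X: prob_space "distr M S X" by (rule prob_space_distr) fact
  interpret Y: prob_space "distr M T Y" by (rule prob_space_distr) fact
  interpret pair_sigma_finite "distr M S X" "distr M T Y" ..
  have "(\<integral>\<omega>. f (X \<omega>, Y \<omega>) \<partial>M) = integral\<^sup>L (distr M S X \<Otimes>\<^sub>M distr M T Y) f"
    unfolding D by (simp add: integral_distr)
  also have "\<dots> = (\<integral>x. (\<integral>y. f (x, y) \<partial>distr M T Y) \<partial>distr M S X)"
    by (rule integral_fst'[symmetric]) (unfold D, simp add: integrable_distr_eq int)
  also have "\<dots> = (\<integral>\<omega>. (\<integral>y. f (X \<omega>, y) \<partial>distr M T Y) \<partial>M)"
    by (subst integral_distr) auto
  finally show ?thesis .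
qed

lemma (in prob_space) has_bochner_integral_indep_mult:
  fixes X Y :: "'a \<Rightarrow> real"
  assumes "indep_var borel X borel Y" "has_bochner_integral M X a" "has_bochner_integral M Y b"
  shows "has_bochner_integral M (\<lambda>\<omega>. X \<omega> * Y \<omega>) (a * b)"
  using assms indep_var_integrable[of X Y] indep_var_lebesgue_integral[of X Y]
  by (auto simp: has_bochner_integral_iff)

section \<open>Exponential laws and the stationary system time\<close>

text \<open>The powers of (1-p)lx over n! form the series of e^((1-p)lx), which reduces the decay
  e^(-lx) to e^(-plx). This is thinning of a Poisson process at the level of densities;
  \<open>erlang_density n\<close> belongs to n+1 hops.\<close>

lemma sums_geometric_erlang:
  assumes "0 \<le> x"
  shows "(\<lambda>n. p * (1 - p) ^ n * erlang_density n l x) sums exponential_density (p * l) x"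
proof -
  have "(\<lambda>n. (p * l * exp (- l * x)) * (((1 - p) * l * x) ^ n /\<^sub>R fact n))
      sums ((p * l * exp (- l * x)) * exp ((1 - p) * l * x))"
    by (intro sums_mult exp_converges)
  moreover have "(p * l * exp (- l * x)) * (((1 - p) * l * x) ^ n /\<^sub>R fact n)
      = p * (1 - p) ^ n * erlang_density n l x" for n
    using assms by (simp add: erlang_density_def power_mult_distrib divide_inverse mult_ac)
  moreover have "(p * l * exp (- l * x)) * exp ((1 - p) * l * x) = exponential_density (p * l) x"
    using assms by (simp add: exponential_density_def exp_add[symmetric] algebra_simps)
  ultimately show ?thesis by (simp only:)
qed

abbreviation exponential_measure :: "real \<Rightarrow> real measure" where
  "exponential_measure l \<equiv> density lborel (\<lambda>x. ennreal (exponential_density l x))"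

lemma real_distribution_exponential:
  assumes "0 < l"
  shows "real_distribution (exponential_measure l)"
  using prob_space_exponential_density[OF assms]
  by (simp add: real_distribution_def real_distribution_axioms_def)

lemma distributed_exponential_iff:
  assumes "X \<in> borel_measurable M"
  shows "distributed M lborel X (\<lambda>x. ennreal (exponential_density l x))
    \<longleftrightarrow> distr M borel X = exponential_measure l"
proof -
  have "distr M borel X = distr M lborel X"
    by (intro distr_cong) simp_all
  then show ?thesis
    using assms by (auto simp: distributed_def)
qed

text \<open>
  Truncating at \<open>t\<close> makes both pieces of the integral elementary; \<open>t \<rightarrow> \<infinity>\<close> yields the
  characteristic function, and \<open>max 0 (t - x) = t - min t x\<close> the transform of the waiting time.
\<close>

lemma integral_iexp_min_exponential:
  assumes "0 < l" "0 \<le> t"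
  shows "(CLINT x|exponential_measure l. iexp (s * min t x))
    = (l - \<i> * s * exp ((\<i> * s - l) * t)) / (l - \<i> * s)"
proof -
  interpret D: real_distribution "exponential_measure l"
    by (rule real_distribution_exponential) fact
  let ?c = "\<i> * complex_of_real s - complex_of_real l"
  have c: "?c \<noteq> 0" "complex_of_real l - \<i> * complex_of_real s \<noteq> 0"
    using assms(1) by (auto simp: complex_eq_iff)
  let ?F = "\<lambda>x. complex_of_real l * exp (?c * of_real x) / ?c"
  have F: "(?F has_vector_derivative l * exp (?c * of_real x)) (at x within A)" for x A
  proof -
    have "((\<lambda>z. complex_of_real l * exp (?c * z) / ?c) has_field_derivative
        complex_of_real l * exp (?c * of_real x)) (at (of_real x))"
      using c by (auto intro!: derivative_eq_intros)
    from has_vector_derivative_real_field[OF this] show ?thesis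
      by simp
  qed
  have "has_bochner_integral lborel (\<lambda>x. indicator {0..t} x *\<^sub>R (l * exp (?c * of_real x))) (?F t - ?F 0)"
    by (rule has_bochner_integral_FTC_Icc[OF assms(2)]) (auto intro!: F continuous_intros)
  then have I1: "(LINT x|lborel. indicator {0..t} x *\<^sub>R (l * exp (?c * of_real x))) = ?F t - ?F 0"
    by (rule has_bochner_integral_integral_eq)
  have iexp: "integrable (exponential_measure l) (\<lambda>x. iexp (s * min t x))"
    by (rule D.integrable_iexp) auto
  have "(CLINT x|exponential_measure l. iexp (s * min t x))
      = (CLINT x|exponential_measure l. indicator {..t} x *\<^sub>R iexp (s * min t x)
          + indicator {t<..} x *\<^sub>R iexp (s * min t x))"
    by (intro Bochner_Integration.integral_cong) (auto split: split_indicator)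
  also have "\<dots> = (CLINT x|exponential_measure l. indicator {..t} x *\<^sub>R iexp (s * min t x))
      + (CLINT x|exponential_measure l. indicator {t<..} x *\<^sub>R iexp (s * min t x))"
    by (intro Bochner_Integration.integral_add integrable_mult_indicator iexp) auto
  also have "(CLINT x|exponential_measure l. indicator {..t} x *\<^sub>R iexp (s * min t x))
      = (LINT x|lborel. exponential_density l x *\<^sub>R (indicator {..t} x *\<^sub>R iexp (s * min t x)))"
    by (rule integral_density) (auto simp: exponential_density_nonneg assms(1))
  also have "\<dots> = (LINT x|lborel. indicator {0..t} x *\<^sub>R (l * exp (?c * of_real x)))"
    by (intro Bochner_Integration.integral_cong)
      (auto simp: exponential_density_def scaleR_conv_of_real exp_of_real[symmetric] exp_add[symmetric]
        algebra_simps split: split_indicator)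
  also have "(CLINT x|exponential_measure l. indicator {t<..} x *\<^sub>R iexp (s * min t x))
      = (CLINT x|exponential_measure l. indicator {t<..} x *\<^sub>R iexp (s * t))"
    by (intro Bochner_Integration.integral_cong) (auto split: split_indicator)
  also have "\<dots> = measure (exponential_measure l) {t<..} *\<^sub>R iexp (s * t)"
    by (subst integral_scaleR_left) (simp_all add: less_top[symmetric])
  also have "measure (exponential_measure l) {t<..} = exp (- t * l)"
    using D.exponential_distributedD_gt[of "\<lambda>x. x" l t] assms distributed_exponential_iff[of "\<lambda>x. x" "exponential_measure l" l]
    by (simp add: distr_id2 greaterThan_def)
  finally show ?thesis
    unfolding I1 using c
    by (simp add: scaleR_conv_of_real exp_of_real[symmetric] exp_add[symmetric] divide_simps)
      (simp add: algebra_simps exp_add[symmetric])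
qed

text \<open>For fixed x the truncated integrand is eventually constant in n and has modulus 1, so
  dominated convergence applies; in the closed form the remaining exponential has modulus
  \<open>exp (- l * n)\<close> and vanishes.\<close>

lemma char_exponential:
  assumes "0 < l"
  shows "char (exponential_measure l) s = l / (l - \<i> * s)"
proof -
  interpret D: real_distribution "exponential_measure l"
    by (rule real_distribution_exponential) fact
  have A: "(\<lambda>n. CLINT x|exponential_measure l. iexp (s * min (real n) x)) \<longlonglongrightarrow> char (exponential_measure l) s"
    unfolding char_def
  proof (rule integral_dominated_convergence[where w = "\<lambda>_. 1"])
    show "AE x in exponential_measure l. (\<lambda>n. iexp (s * min (real n) x)) \<longlonglongrightarrow> iexp (s * x)"
    proof (intro AE_I2 tendsto_eventually)
      fix x :: real
      obtain N where "x \<le> real N" using real_arch_simple by blast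
      then show "\<forall>\<^sub>F n in sequentially. iexp (s * min (real n) x) = iexp (s * x)"
        by (intro eventually_sequentiallyI[of N]) (simp add: min_absorb2)
    qed
  qed (auto simp del: of_real_mult)
  have B: "(\<lambda>n. (l - \<i> * s * exp ((\<i> * s - l) * real n)) / (l - \<i> * s))
      \<longlonglongrightarrow> (l - \<i> * s * 0) / (l - \<i> * s)"
  proof (intro tendsto_intros)
    have "(\<lambda>n. exp (- l * real n)) \<longlonglongrightarrow> 0"
      using assms by real_asymp
    then show "(\<lambda>n. exp ((\<i> * s - l) * of_real (real n))) \<longlonglongrightarrow> 0"
      by (subst tendsto_norm_zero_iff[symmetric]) (simp add: mult_ac)
    show "complex_of_real l - \<i> * complex_of_real s \<noteq> 0"
      using assms by (auto simp: complex_eq_iff)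
  qed
  have eq: "(CLINT x|exponential_measure l. iexp (s * min (real n) x))
      = (l - \<i> * s * exp ((\<i> * s - l) * real n)) / (l - \<i> * s)" for n
    by (rule integral_iexp_min_exponential) (use assms in auto)
  show ?thesis
    using LIMSEQ_unique[OF A[unfolded eq] B] by simp
qed

text \<open>Exponential tilting: the weight e^(-rx) turns the density of rate l into l/(l+r) times
  the density of rate l+r, whose i-th moment is known. The cases i = 0 and i = 2 are the factors of
  the waiting-time product.\<close>

lemma (in prob_space) nn_integral_exponential_power_times_exp:
  assumes X: "distributed M lborel X (exponential_density l)" and "0 < l" "0 \<le> r"
  shows "(\<integral>\<^sup>+\<omega>. ennreal (X \<omega> ^ i * exp (- r * X \<omega>)) \<partial>M)
    = ennreal (l / (l + r) * (fact i / (l + r) ^ i))"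
proof -
  have "(\<integral>\<^sup>+\<omega>. ennreal (X \<omega> ^ i * exp (- r * X \<omega>)) \<partial>M)
      = (\<integral>\<^sup>+x. ennreal (exponential_density l x) * ennreal (x ^ i * exp (- r * x)) \<partial>lborel)"
    by (rule distributed_nn_integral[OF X, symmetric]) measurable
  also have "\<dots> = (\<integral>\<^sup>+x. ennreal (l / (l + r)) * ennreal (exponential_density (l + r) x * x ^ i) \<partial>lborel)"
  proof (intro nn_integral_cong)
    fix x :: real
    have "l / (l + r) * (exponential_density (l + r) x * x ^ i) = (if x < 0 then 0 else l * exp (- x * (l + r)) * x ^ i)"
      using assms by (auto simp: exponential_density_def)
    also have "\<dots> = exponential_density l x * (x ^ i * exp (- r * x))"
      by (simp add: exponential_density_def exp_add[symmetric] algebra_simps)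
    finally have "l / (l + r) * (exponential_density (l + r) x * x ^ i) = exponential_density l x * (x ^ i * exp (- r * x))" .
    then show "ennreal (exponential_density l x) * ennreal (x ^ i * exp (- r * x))
      = ennreal (l / (l + r)) * ennreal (exponential_density (l + r) x * x ^ i)"
      using assms by (simp add: ennreal_mult'[symmetric] exponential_density_nonneg)
  qed
  also have "\<dots> = ennreal (l / (l + r)) * ennreal (fact i / (l + r) ^ i)"
    using nn_integral_erlang_ith_moment[of "l + r" 0 i] assms
    by (subst nn_integral_cmult) auto
  finally show ?thesis
    using assms by (simp add: ennreal_mult'[symmetric])
qed

text \<open>Memorylessness: the value x is exceeded with probability e^(-lx), and the overshoot is
  again exponential, with mean 1/l. The substitution t = x + u makes this a density
  computation.\<close>

lemma nn_integral_exponential_excess: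
  assumes "0 < l" "0 \<le> x"
  shows "(\<integral>\<^sup>+t. ennreal (max 0 (t - x)) \<partial>exponential_measure l) = ennreal (exp (- l * x) / l)"
proof -
  have "(\<integral>\<^sup>+t. ennreal (max 0 (t - x)) \<partial>exponential_measure l)
      = (\<integral>\<^sup>+t. ennreal (exponential_density l t) * ennreal (max 0 (t - x)) \<partial>lborel)"
    by (rule nn_integral_density) auto
  also have "\<dots> = (\<integral>\<^sup>+u. ennreal (exponential_density l (x + 1 * u)) * ennreal (max 0 (x + 1 * u - x)) \<partial>lborel)"
    by (subst nn_integral_real_affine[where c = 1 and t = x]) auto
  also have "\<dots> = (\<integral>\<^sup>+u. ennreal (exp (- l * x)) * ennreal (exponential_density l u * u ^ 1) \<partial>lborel)"
  proof (intro nn_integral_cong)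
    fix u :: real
    have "ennreal (exponential_density l (x + 1 * u)) * ennreal (max 0 (x + 1 * u - x))
        = ennreal (exponential_density l (x + 1 * u) * max 0 (x + 1 * u - x))"
      by (rule ennreal_mult'[symmetric]) (simp add: exponential_density_nonneg assms(1))
    also have "exponential_density l (x + 1 * u) * max 0 (x + 1 * u - x)
        = exp (- l * x) * (exponential_density l u * u ^ 1)"
      using assms(2) by (auto simp: exponential_density_def max_def exp_add[symmetric] algebra_simps)
    also have "ennreal (exp (- l * x) * (exponential_density l u * u ^ 1))
        = ennreal (exp (- l * x)) * ennreal (exponential_density l u * u ^ 1)"
      by (rule ennreal_mult') simp
    finally show "ennreal (exponential_density l (x + 1 * u)) * ennreal (max 0 (x + 1 * u - x))
        = ennreal (exp (- l * x)) * ennreal (exponential_density l u * u ^ 1)" .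
  qed
  also have "\<dots> = ennreal (exp (- l * x)) * ennreal (1 / l)"
    using nn_integral_erlang_ith_moment[of l 0 1] assms(1)
    by (subst nn_integral_cmult) auto
  finally show ?thesis
    using assms by (simp add: ennreal_mult'[symmetric])
qed

text \<open>
  With \<open>L = E e\<^bsup>-\<nu>T\<^esup>\<close>, the fixed-point equation reads \<open>((\<mu> - \<nu>) - is) \<phi>(s) = \<mu> L\<close> for \<open>s \<noteq> 0\<close>;
  continuity of the characteristic function \<open>\<phi>\<close> at 0 determines \<open>L\<close>.
\<close>

lemma (in prob_space) stationary_system_time_exponential:
  assumes rates: "0 < \<nu>" "\<nu> < \<mu>"
    and indTX: "indep_var borel T borel X"
    and indWS: "indep_var borel (\<lambda>\<omega>. max 0 (T \<omega> - X \<omega>)) borel S"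
    and T_nonneg: "AE \<omega> in M. 0 \<le> T \<omega>"
    and X: "distr M borel X = exponential_measure \<nu>"
    and S: "distr M borel S = exponential_measure \<mu>"
    and stat: "distr M borel (\<lambda>\<omega>. max 0 (T \<omega> - X \<omega>) + S \<omega>) = distr M borel T"
  shows "distr M borel T = exponential_measure (\<mu> - \<nu>)"
proof (rule Levy_uniqueness)
  have [measurable]: "T \<in> borel_measurable M" "X \<in> borel_measurable M" "S \<in> borel_measurable M"
    using indTX indWS by (auto simp: indep_var_distribution_eq)
  interpret T: real_distribution "distr M borel T"
    by (rule real_distribution_distr) simp
  show "real_distribution (distr M borel T)" by unfold_locales
  show "real_distribution (exponential_measure (\<mu> - \<nu>))"
    using rates by (intro real_distribution_exponential) simp
  define \<phi> where "\<phi> = char (distr M borel T)"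
  define L :: complex where "L = (CLINT \<omega>|M. complex_of_real (exp (- \<nu> * T \<omega>)))"
  have int_T: "integrable M (\<lambda>\<omega>. iexp (s * T \<omega>))" for s
    by (rule integrable_iexp) auto
  \<comment> \<open>Nonnegativity of T is what bounds this integrand by 1.\<close>
  have int_L: "integrable M (\<lambda>\<omega>. complex_of_real (exp (- \<nu> * T \<omega>)))"
    by (rule integrable_const_bound[where B = 1])
      (use T_nonneg rates in \<open>auto elim!: eventually_mono\<close>)
  have nz: "complex_of_real a - \<i> * complex_of_real s \<noteq> 0"
    "complex_of_real a + \<i> * complex_of_real s \<noteq> 0" if "a > 0" for a s
    using that by (auto simp: complex_eq_iff)
  have W: "(CLINT \<omega>|M. iexp (s * max 0 (T \<omega> - X \<omega>)))
      = (\<nu> * \<phi> s + \<i> * s * L) / (\<nu> + \<i> * s)" for s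
  proof -
    have "(CLINT \<omega>|M. iexp (s * max 0 (T \<omega> - X \<omega>)))
      = (CLINT \<omega>|M. (CLINT x|exponential_measure \<nu>. iexp (s * max 0 (T \<omega> - x))))"
    proof -
      have "integrable M (\<lambda>\<omega>. iexp (s * max 0 (T \<omega> - X \<omega>)))"
        by (rule integrable_iexp) auto
      then show ?thesis
        using integral_indep_var[OF indTX, of "\<lambda>(t, x). iexp (s * max 0 (t - x))"] X by simp
    qed
    also have "\<dots> = (CLINT \<omega>|M. (\<nu> * iexp (s * T \<omega>) + \<i> * s * complex_of_real (exp (- \<nu> * T \<omega>))) / (\<nu> + \<i> * s))"
    proof (rule integral_cong_AE)
      show "(\<lambda>\<omega>. CLINT x|exponential_measure \<nu>. iexp (s * max 0 (T \<omega> - x))) \<in> borel_measurable M"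
      proof -
        interpret E: real_distribution "exponential_measure \<nu>"
          by (rule real_distribution_exponential) (rule rates)
        show ?thesis by measurable
      qed
      show "AE \<omega> in M. (CLINT x|exponential_measure \<nu>. iexp (s * max 0 (T \<omega> - x)))
        = (\<nu> * iexp (s * T \<omega>) + \<i> * s * complex_of_real (exp (- \<nu> * T \<omega>))) / (\<nu> + \<i> * s)"
        using T_nonneg
      proof eventually_elim
        fix \<omega> assume "0 \<le> T \<omega>"
        define t where "t = T \<omega>"
        have "(CLINT x|exponential_measure \<nu>. iexp (s * max 0 (t - x)))
          = (CLINT x|exponential_measure \<nu>. iexp (s * t) * iexp ((- s) * min t x))"
          by (intro Bochner_Integration.integral_cong refl)
            (auto simp: exp_add[symmetric] max_def min_def algebra_simps)
        also have "\<dots> = iexp (s * t) * ((\<nu> - \<i> * (- s) * exp ((\<i> * (- s) - \<nu>) * t)) / (\<nu> - \<i> * (- s)))"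
          using integral_iexp_min_exponential[OF rates(1), of t "- s"] \<open>0 \<le> T \<omega>\<close>
          by (simp add: t_def)
        also have "\<dots> = (\<nu> * iexp (s * t) + \<i> * s * (exp ((\<i> * (- s) - \<nu>) * t) * iexp (s * t))) / (\<nu> + \<i> * s)"
          by (simp add: algebra_simps)
        also have "exp ((\<i> * (- s) - \<nu>) * t) * iexp (s * t) = complex_of_real (exp (- \<nu> * t))"
          by (simp add: exp_add[symmetric] exp_of_real[symmetric] algebra_simps)
        finally show "(CLINT x|exponential_measure \<nu>. iexp (s * max 0 (T \<omega> - x)))
          = (\<nu> * iexp (s * T \<omega>) + \<i> * s * complex_of_real (exp (- \<nu> * T \<omega>))) / (\<nu> + \<i> * s)"
          unfolding t_def .
      qed
    qed measurable
    also have "\<dots> = (\<nu> * (CLINT \<omega>|M. iexp (s * T \<omega>)) + \<i> * s * L) / (\<nu> + \<i> * s)"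
      unfolding L_def using int_T[of s] int_L by simp
    also have "(CLINT \<omega>|M. iexp (s * T \<omega>)) = \<phi> s"
      by (simp add: \<phi>_def char_def integral_distr)
    finally show ?thesis .
  qed
  have eq: "\<phi> s = (\<nu> * \<phi> s + \<i> * s * L) / (\<nu> + \<i> * s) * (\<mu> / (\<mu> - \<i> * s))" for s
  proof -
    have "\<phi> s = char (distr M borel (\<lambda>\<omega>. max 0 (T \<omega> - X \<omega>))) s * char (distr M borel S) s"
      unfolding \<phi>_def stat[symmetric] by (rule char_distr_add[OF indWS])
    also have "char (distr M borel (\<lambda>\<omega>. max 0 (T \<omega> - X \<omega>))) s = (\<nu> * \<phi> s + \<i> * s * L) / (\<nu> + \<i> * s)"
      unfolding char_def W[symmetric] by (subst integral_distr) simp_all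
    also have "char (distr M borel S) s = \<mu> / (\<mu> - \<i> * s)"
      unfolding S using rates by (intro char_exponential) simp
    finally show ?thesis .
  qed
  have key: "((\<mu> - \<nu>) - \<i> * s) * \<phi> s = \<mu> * L" if "s \<noteq> 0" for s
  proof -
    have "\<phi> s * ((\<nu> + \<i> * s) * (\<mu> - \<i> * s)) = (\<nu> * \<phi> s + \<i> * s * L) * \<mu>"
    proof -
      have "a = b / c * (d / e) \<Longrightarrow> c \<noteq> 0 \<Longrightarrow> e \<noteq> 0 \<Longrightarrow> a * (c * e) = b * d" for a b c d e :: complex
        by (simp add: field_simps)
      from this[OF eq] show ?thesis using nz[of \<nu> s] nz[of \<mu> s] rates by simp
    qed
    \<comment> \<open>After expansion the terms \<nu>\<mu>\<phi>(s) cancel and a common factor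
      \<open>\<i> * s\<close> remains on both sides; dividing by it is the reason for excluding s =
      0.\<close>
    then have "\<i> * s * (((\<mu> - \<nu>) - \<i> * s) * \<phi> s) = \<i> * s * (\<mu> * L)"
      by (simp add: algebra_simps)
    then show ?thesis using that by simp
  qed
  have "(\<lambda>s. ((\<mu> - \<nu>) - \<i> * of_real s) * \<phi> s) \<midarrow>0\<rightarrow> ((\<mu> - \<nu>) - \<i> * of_real 0) * \<phi> 0"
    using T.isCont_char[of 0] unfolding \<phi>_def isCont_def by (intro tendsto_intros)
  moreover have "(\<lambda>s. ((\<mu> - \<nu>) - \<i> * of_real s) * \<phi> s) \<midarrow>0\<rightarrow> \<mu> * L"
    by (rule tendsto_eventually) (use key in \<open>auto simp: eventually_at_filter\<close>)
  ultimately have "((\<mu> - \<nu>) - \<i> * of_real 0) * \<phi> 0 = \<mu> * L"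
    by (rule LIM_unique)
  then have L: "\<mu> * L = \<mu> - \<nu>"
    using T.char_zero by (simp add: \<phi>_def)
  show "char (distr M borel T) = char (exponential_measure (\<mu> - \<nu>))"
  proof
    fix s
    have "\<phi> s = (\<mu> - \<nu>) / ((\<mu> - \<nu>) - \<i> * s)"
    proof (cases "s = 0")
      case True
      then show ?thesis using T.char_zero rates by (simp add: \<phi>_def)
    next
      case False
      then show ?thesis
        using key[OF False] L nz(1)[of "\<mu> - \<nu>" s] rates by (simp add: field_simps)
    qed
    then show "char (distr M borel T) s = char (exponential_measure (\<mu> - \<nu>)) s"
      using rates by (simp add: \<phi>_def char_exponential)
  qed
qed

section \<open>Regeneration at polled waypoints\<close>

lemma polled_index_step:
  assumes "\<forall>n. \<exists>k>n. polled R k \<omega>"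
  shows "polled_index R i \<omega> < polled_index R (Suc i) \<omega>"
    and "polled R (polled_index R (Suc i) \<omega>) \<omega>"
proof -
  have "\<exists>n. n > polled_index R i \<omega> \<and> polled R n \<omega>"
    using assms by blast
  from LeastI_ex[OF this]
  show "polled_index R i \<omega> < polled_index R (Suc i) \<omega>"
    and "polled R (polled_index R (Suc i) \<omega>) \<omega>"
    by simp_all
qed

lemma polled_index_mono:
  assumes "\<forall>n. \<exists>k>n. polled R k \<omega>" and "i \<le> j"
  shows "polled_index R i \<omega> \<le> polled_index R j \<omega>"
  using assms(2)
proof (induction j rule: dec_induct)
  case (step n)
  then show ?case using polled_index_step(1)[OF assms(1), of n] by linarith
qed simp

text \<open>Each \<open>LEAST\<close> search up to update i succeeds at or before waypoint m, so
  polls beyond m cannot influence it. The two records may live on different sample spaces; one of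
  them will be a path padded with default values.\<close>

lemma queue_local:
  assumes inf: "\<forall>n. \<exists>k>n. polled R k \<omega>" "\<forall>n. \<exists>k>n. polled R' k \<omega>'"
    and N: "polled_index R i \<omega> = m"
    and eq_init: "initial_time R \<omega> = initial_time R' \<omega>'"
    and eq: "\<And>n. n \<in> {1..m} \<Longrightarrow> hop R n \<omega> = hop R' n \<omega>'"
      "\<And>n. n \<in> {1..m} \<Longrightarrow> polled R n \<omega> = polled R' n \<omega>'"
      "\<And>j. j \<in> {1..i} \<Longrightarrow> service R j \<omega> = service R' j \<omega>'"
    and "j \<le> i"
  shows "polled_index R' j \<omega>' = polled_index R j \<omega> \<and> system_time R' j \<omega>' = system_time R j \<omega>"
  using \<open>j \<le> i\<close>
proof (induction j)
  case 0
  then show ?case by (simp add: eq_init)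
next
  case (Suc j)
  let ?a = "polled_index R j \<omega>" and ?b = "polled_index R (Suc j) \<omega>"
  from Suc have IH: "polled_index R' j \<omega>' = ?a" "system_time R' j \<omega>' = system_time R j \<omega>"
    by auto
  have lt: "?a < ?b" and polled: "polled R ?b \<omega>"
    using polled_index_step[OF inf(1)] by auto
  have le: "?b \<le> m"
    using polled_index_mono[OF inf(1) \<open>Suc j \<le> i\<close>] N by simp
  have least: "\<not> polled R n \<omega>" if "?a < n" "n < ?b" for n
    using that not_less_Least[of n "\<lambda>n. n > ?a \<and> polled R n \<omega>"] by simp
  have b: "polled_index R' (Suc j) \<omega>' = ?b"
    unfolding polled_index.simps(2)[of R'] IH
  proof (rule Least_equality)
    show "?a < ?b \<and> polled R' ?b \<omega>'"
      using lt polled le eq(2)[of ?b] by (simp del: polled_index.simps)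
    \<comment> \<open>A smaller candidate for R' would lie below m, where both records agree, and
      would contradict minimality in R.\<close>
    show "?b \<le> n" if "?a < n \<and> polled R' n \<omega>'" for n
    proof (rule ccontr)
      assume "\<not> ?b \<le> n"
      with that least[of n] eq(2)[of n] le show False by (simp del: polled_index.simps)
    qed
  qed
  have "interarrival R' (Suc j) \<omega>' = interarrival R (Suc j) \<omega>"
    unfolding interarrival_def hop_count_def hop_duration_def diff_Suc_1 IH b
    by (intro sum.cong refl eq(1)[symmetric]) (use le in \<open>auto simp del: polled_index.simps\<close>)
  moreover have "service R' (Suc j) \<omega>' = service R (Suc j) \<omega>"
    using eq(3)[of "Suc j"] Suc.prems by simp
  ultimately show ?case
    using b IH by simp
qed

section \<open>Restarting the sources at a polled update\<close>

definition sources :: "source set" where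
  "sources = UNIV - {Hop 0, Poll 0, Serv 0}"

definition past_sources :: "nat \<Rightarrow> nat \<Rightarrow> source set" where
  "past_sources m i = insert Init (Hop ` {1..m} \<union> Poll ` {1..m} \<union> Serv ` {1..i})"

text \<open>Hops and polls are numbered by waypoints, services by polled updates, hence two separate
  offsets. \<open>Init\<close> is a fixed point: after a restart its coordinate is filled with the
  current system time.\<close>

primrec shift_source :: "nat \<Rightarrow> nat \<Rightarrow> source \<Rightarrow> source" where
  "shift_source m i Init = Init"
| "shift_source m i (Hop n) = Hop (m + n)"
| "shift_source m i (Poll n) = Poll (m + n)"
| "shift_source m i (Serv n) = Serv (i + n)"

text \<open>The canonical queue on path space. It turns quantities such as \<open>Q\<close> into
  functionals of the vector of sources, so that equality of laws on path space transfers to them;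
  the test for 1 decodes the polling indicator.\<close>

definition coordinate_queue :: "(source \<Rightarrow> real) waypoint_queue" where
  "coordinate_queue = \<lparr>hop = (\<lambda>n x. x (Hop n)), polled = (\<lambda>n x. x (Poll n) = 1),
     service = (\<lambda>n x. x (Serv n)), initial_time = (\<lambda>x. x Init)\<rparr>"

lemma coordinate_queue_simps [simp]:
  "hop coordinate_queue n x = x (Hop n)"
  "polled coordinate_queue n x \<longleftrightarrow> x (Poll n) = 1"
  "service coordinate_queue n x = x (Serv n)"
  "initial_time coordinate_queue x = x Init"
  by (simp_all add: coordinate_queue_def)

definition restarted :: "'a waypoint_queue \<Rightarrow> nat \<Rightarrow> 'a \<Rightarrow> source \<Rightarrow> real" where
  "restarted R i \<omega> = (\<lambda>s\<in>sources. if s = Init then system_time R i \<omega>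
     else source_var R (shift_source (polled_index R i \<omega>) i s) \<omega>)"

lemma sources_simps [simp]:
  "Init \<in> sources" "Hop n \<in> sources \<longleftrightarrow> n \<noteq> 0" "Poll n \<in> sources \<longleftrightarrow> n \<noteq> 0" "Serv n \<in> sources \<longleftrightarrow> n \<noteq> 0"
  by (auto simp: sources_def)

lemma restarted_first_polled_index:
  assumes "\<forall>n. \<exists>k>n. polled R k \<omega>"
  shows "polled_index R (Suc i) \<omega> =
    polled_index R i \<omega> + polled_index coordinate_queue (Suc 0) (restarted R i \<omega>)"
proof -
  let ?a = "polled_index R i \<omega>" and ?b = "polled_index R (Suc i) \<omega>"
  have lt: "?a < ?b" and polled: "polled R ?b \<omega>"
    using polled_index_step[OF assms] by auto
  have P: "polled coordinate_queue n (restarted R i \<omega>) = polled R (?a + n) \<omega>" if "n > 0" for n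
    using that by (simp add: restarted_def)
  have "(LEAST n. n > 0 \<and> polled coordinate_queue n (restarted R i \<omega>)) = ?b - ?a"
  proof (rule Least_equality)
    show "?b - ?a > 0 \<and> polled coordinate_queue (?b - ?a) (restarted R i \<omega>)"
      using P[of "?b - ?a"] lt polled by (simp del: polled_index.simps coordinate_queue_simps)
    show "?b - ?a \<le> n" if "n > 0 \<and> polled coordinate_queue n (restarted R i \<omega>)" for n
    proof -
      have "?a + n > ?a \<and> polled R (?a + n) \<omega>"
        using that P[of n] by auto
      then have "?b \<le> ?a + n"
        unfolding polled_index.simps(2) by (rule Least_le)
      then show ?thesis by linarith
    qed
  qed
  then show ?thesis using lt by simp
qed

text \<open>Everything in the interval after update i is read from the system time at i, later hops
  and polls, and service i+1, all of which are coordinates of the restarted vector. Stationarity of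
  \<open>Q\<close> thereby reduces to stationarity of that vector.\<close>

lemma restarted_Q:
  assumes "\<forall>n. \<exists>k>n. polled R k \<omega>"
  shows "Q R v (Suc i) \<omega> = Q coordinate_queue v (Suc 0) (restarted R i \<omega>)"
proof -
  let ?z = "restarted R i \<omega>"
  have count: "hop_count R (Suc i) \<omega> = hop_count coordinate_queue (Suc 0) ?z"
    using restarted_first_polled_index[OF assms, of i] by (simp add: hop_count_def)
  have dur: "hop_duration R (Suc i) j \<omega> = hop_duration coordinate_queue (Suc 0) j ?z"
    if "j \<ge> 1" for j
    using that by (simp add: hop_duration_def restarted_def)
  have "interarrival R (Suc i) \<omega> = interarrival coordinate_queue (Suc 0) ?z"
    unfolding interarrival_def count by (intro sum.cong) (auto simp: dur)
  then have "system_time R (Suc i) \<omega> = system_time coordinate_queue (Suc 0) ?z"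
    by (simp add: restarted_def)
  moreover have "G1 R v (Suc i) \<omega> = G1 coordinate_queue v (Suc 0) ?z"
    unfolding G1_def count by (intro sum.cong) (auto simp: dur)
  moreover have "H R v (Suc i) \<omega> = H coordinate_queue v (Suc 0) ?z"
    unfolding H_def count by (intro sum.cong) (auto simp: dur)
  moreover have "G2 R v (Suc i) \<omega> = G2 coordinate_queue v (Suc 0) ?z"
    unfolding G2_def count by (intro sum.cong arg_cong2[where f = "(*)"]) (auto simp: dur)
  ultimately show ?thesis
    by (simp add: Q_def G3_def)
qed

text \<open>Index 0 is excluded because the entries at 0 are unconstrained.\<close>

locale measurable_waypoint_queue =
  fixes M :: "'a measure" and R :: "'a waypoint_queue"
  assumes measurable_source [measurable]:
    "\<And>n. n \<noteq> 0 \<Longrightarrow> hop R n \<in> borel_measurable M"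
    "\<And>n. n \<noteq> 0 \<Longrightarrow> Measurable.pred M (polled R n)"
    "\<And>n. n \<noteq> 0 \<Longrightarrow> service R n \<in> borel_measurable M"
    "initial_time R \<in> borel_measurable M"
begin

lemma measurable_polled_index [measurable]:
  "polled_index R i \<in> measurable M (count_space UNIV)"
proof (induction i)
  case 0
  have "polled_index R 0 = (\<lambda>_. 0)" by (rule ext) simp
  then show ?case by simp
next
  case (Suc i)
  note [measurable] = Suc
  \<comment> \<open>At n = 0 the conjunction is constantly false; for other n the polling event is
    measurable.\<close>
  have *: "Measurable.pred M (\<lambda>\<omega>. n > polled_index R i \<omega> \<and> polled R n \<omega>)" for n
    by (cases "n = 0") simp_all
  show ?case
    unfolding polled_index.simps(2) by (intro measurable_Least *)
qed

lemma measurable_hop_count [measurable]: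
  "hop_count R i \<in> measurable M (count_space UNIV)"
  unfolding hop_count_def by measurable

lemma measurable_hop_duration [measurable]:
  assumes "j \<noteq> 0"
  shows "hop_duration R i j \<in> borel_measurable M"
  unfolding hop_duration_def
  by (rule measurable_compose_countable[OF _ measurable_polled_index])
    (use assms in simp)

text \<open>The summation limit is random but takes countably many values, so measurability for each
  fixed limit suffices.\<close>

lemma measurable_sum_hops:
  assumes "\<And>j. j \<noteq> 0 \<Longrightarrow> f j \<in> borel_measurable M"
  shows "(\<lambda>\<omega>. (\<Sum>j=1..hop_count R i \<omega>. f j \<omega>) :: real) \<in> borel_measurable M"
  by (rule measurable_compose_countable[OF _ measurable_hop_count])
    (intro borel_measurable_sum assms, simp)

lemma measurable_interarrival [measurable]: "interarrival R i \<in> borel_measurable M"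
  unfolding interarrival_def by (intro measurable_sum_hops) measurable

lemma measurable_system_time [measurable]: "system_time R i \<in> borel_measurable M"
proof (induction i)
  case 0
  have "system_time R 0 = initial_time R" by (rule ext) simp
  then show ?case by simp
next
  case (Suc i)
  note [measurable] = Suc
  show ?case unfolding system_time.simps(2) by measurable
qed

lemma measurable_Q [measurable]: "Q R v i \<in> borel_measurable M"
proof -
  have [measurable]: "G1 R v i \<in> borel_measurable M"
    unfolding G1_def by (intro measurable_sum_hops) measurable
  have [measurable]: "H R v i \<in> borel_measurable M"
    unfolding H_def by (intro measurable_sum_hops) measurable
  have [measurable]: "G2 R v i \<in> borel_measurable M"
    unfolding G2_def
    by (intro measurable_sum_hops borel_measurable_times borel_measurable_sum) auto
  show ?thesis
    unfolding Q_def G3_def by measurable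
qed

end

lemma measurable_coordinate_queue:
  "measurable_waypoint_queue (PiM sources (\<lambda>_. borel)) coordinate_queue"
proof
  show "hop coordinate_queue n \<in> borel_measurable (PiM sources (\<lambda>_. borel))" if "n \<noteq> 0" for n
    using that by (simp add: coordinate_queue_def)
  show "service coordinate_queue n \<in> borel_measurable (PiM sources (\<lambda>_. borel))" if "n \<noteq> 0" for n
    using that by (simp add: coordinate_queue_def)
  show "initial_time coordinate_queue \<in> borel_measurable (PiM sources (\<lambda>_. borel))"
    by (simp add: coordinate_queue_def)
  show "Measurable.pred (PiM sources (\<lambda>_. borel)) (polled coordinate_queue n)" if "n \<noteq> 0" for n
    using that by (simp add: coordinate_queue_def)
qed

lemma inj_shift_source: "inj (shift_source m i)"
proof
  fix s t assume "shift_source m i s = shift_source m i t"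
  then show "s = t" by (cases s; cases t) simp_all
qed

section \<open>Probabilities of polling patterns\<close>

locale mm1_waypoint_queue = prob_space M
  for M :: "'a measure" and lam \<mu> p :: real and R :: "'a waypoint_queue" +
  assumes rates: "0 < lam" "0 < \<mu>" and polling_prob: "0 < p" "p \<le> 1"
    and queue: "MM1_waypoint_queue M lam \<mu> p R"
begin

lemma indep_sources: "indep_vars (\<lambda>_. borel) (source_var R) sources"
  using queue by (simp add: MM1_waypoint_queue_def sources_def)

lemma distributed_hop: "n \<noteq> 0 \<Longrightarrow> distributed M lborel (hop R n) (exponential_density lam)"
  using queue by (simp add: MM1_waypoint_queue_def)

lemma distributed_service:
  "n \<noteq> 0 \<Longrightarrow> distributed M lborel (service R n) (exponential_density \<mu>)"
  using queue by (simp add: MM1_waypoint_queue_def)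

lemma prob_polled: "n \<noteq> 0 \<Longrightarrow> prob {\<omega> \<in> space M. polled R n \<omega>} = p"
  using queue by (simp add: MM1_waypoint_queue_def)

lemma random_source [measurable]: "s \<in> sources \<Longrightarrow> random_variable borel (source_var R s)"
  using indep_sources unfolding indep_vars_def by simp

sublocale measurable_waypoint_queue M R
proof
  show "hop R n \<in> borel_measurable M" if "n \<noteq> 0" for n
    using random_source[of "Hop n"] that by simp
  show "service R n \<in> borel_measurable M" if "n \<noteq> 0" for n
    using random_source[of "Serv n"] that by simp
  show "initial_time R \<in> borel_measurable M"
    using random_source[of Init] by simp
  show "Measurable.pred M (polled R n)" if "n \<noteq> 0" for n
  proof -
    have "(\<lambda>\<omega>. of_bool (polled R n \<omega>) :: real) \<in> borel_measurable M"
      using random_source[of "Poll n"] that by simp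
    then have "Measurable.pred M (\<lambda>\<omega>. of_bool (polled R n \<omega>) = (1::real))"
      by measurable
    then show ?thesis by simp
  qed
qed

lemma prob_not_polled:
  assumes "n \<noteq> 0"
  shows "prob {\<omega> \<in> space M. \<not> polled R n \<omega>} = 1 - p"
proof -
  have "{\<omega> \<in> space M. polled R n \<omega>} \<in> events"
    using measurable_source(2)[OF assms] by simp
  from prob_neg[OF this] show ?thesis
    using prob_polled[OF assms] by simp
qed

lemma prob_polling_pattern:
  assumes "finite A" "0 \<notin> A"
  shows "prob {\<omega> \<in> space M. \<forall>n\<in>A. polled R n \<omega> = b n} = (\<Prod>n\<in>A. if b n then p else 1 - p)"
proof (cases "A = {}")
  case True
  then show ?thesis by (simp add: prob_space)
next
  case False
  have inj: "inj_on Poll A" by (simp add: inj_on_def)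
  \<comment> \<open>A polling decision is the preimage of the single point 0 or 1 under its
    indicator; \<open>UNIV\<close> is a default for sources that are not polls.\<close>
  let ?B = "\<lambda>s. case s of Poll n \<Rightarrow> {of_bool (b n)} | _ \<Rightarrow> (UNIV :: real set)"
  have "prob (\<Inter>s\<in>Poll ` A. source_var R s -` ?B s \<inter> space M)
      = (\<Prod>s\<in>Poll ` A. prob (source_var R s -` ?B s \<inter> space M))"
    by (rule indep_varsD[OF indep_sources])
      (use assms False in \<open>auto simp: image_iff split: source.split intro: gr0I\<close>)
  also have "\<dots> = (\<Prod>n\<in>A. prob (source_var R (Poll n) -` ?B (Poll n) \<inter> space M))"
    by (subst prod.reindex[OF inj]) simp
  also have "\<dots> = (\<Prod>n\<in>A. if b n then p else 1 - p)"
  proof (intro prod.cong refl)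
    fix n assume "n \<in> A"
    then have "n \<noteq> 0" using assms(2) by metis
    have "source_var R (Poll n) -` ?B (Poll n) \<inter> space M
        = {\<omega> \<in> space M. if b n then polled R n \<omega> else \<not> polled R n \<omega>}"
      by auto
    then show "prob (source_var R (Poll n) -` ?B (Poll n) \<inter> space M) = (if b n then p else 1 - p)"
      using prob_polled[OF \<open>n \<noteq> 0\<close>] prob_not_polled[OF \<open>n \<noteq> 0\<close>] by simp
  qed
  also have "(\<Inter>s\<in>Poll ` A. source_var R s -` ?B s \<inter> space M)
      = {\<omega> \<in> space M. \<forall>n\<in>A. polled R n \<omega> = b n}"
    using False by auto
  finally show ?thesis .
qed

text \<open>If polling stops after n, then the next L waypoints are all unpolled, which has
  probability (1-p)^L for every L; this tends to 0 because p > 0.\<close>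

lemma AE_infinitely_polled: "AE \<omega> in M. \<forall>n. \<exists>k>n. polled R k \<omega>"
proof (subst AE_all_countable, rule allI)
  fix n :: nat
  let ?E = "{\<omega> \<in> space M. \<forall>k>n. \<not> polled R k \<omega>}"
  \<comment> \<open>Indices of the form \<open>Suc (n + k)\<close> exhibit a countable intersection
    over positive indices, where \<open>polled\<close> is measurable.\<close>
  have E: "?E = {\<omega> \<in> space M. \<forall>k. \<not> polled R (Suc (n + k)) \<omega>}"
    by (auto dest: less_imp_Suc_add)
  have [measurable]: "?E \<in> events"
    unfolding E by measurable
  have "prob ?E \<le> (1 - p) ^ L" for L
  proof -
    have "prob ?E \<le> prob {\<omega> \<in> space M. \<forall>k\<in>{n<..n+L}. polled R k \<omega> = False}"
    proof (rule finite_measure_mono)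
      have "Measurable.pred M (\<lambda>\<omega>. \<forall>k\<in>{n<..n+L}. polled R k \<omega> = False)"
        by (intro pred_intros_finite) (auto intro!: measurable_source)
      then show "{\<omega> \<in> space M. \<forall>k\<in>{n<..n+L}. polled R k \<omega> = False} \<in> events"
        by simp
    qed auto
    also have "\<dots> = (1 - p) ^ L"
      by (subst prob_polling_pattern) simp_all
    finally show ?thesis .
  qed
  moreover have "(\<lambda>L. (1 - p) ^ L) \<longlonglongrightarrow> 0"
    by (rule LIMSEQ_realpow_zero) (use polling_prob in auto)
  ultimately have "prob ?E \<le> 0"
    by (intro LIMSEQ_le_const) auto
  then have "prob ?E = 0"
    by (simp add: measure_le_0_iff)
  then have "AE \<omega> in M. \<omega> \<notin> ?E"
    by (subst AE_iff_measurable[OF _ refl]) (auto simp: emeasure_eq_measure Int_def)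
  with AE_space show "AE \<omega> in M. \<exists>k>n. polled R k \<omega>"
    by eventually_elim auto
qed

end

section \<open>Separating past and future sources\<close>

lemma past_sources_subset: "past_sources m i \<subseteq> sources"
  by (auto simp: past_sources_def)

text \<open>\<open>Init\<close> belongs to the past and is fixed by the shift, so it has to be
  removed for the shifted index set to be disjoint from the past.\<close>

definition future_sources :: "source set" where
  "future_sources = sources - {Init}"

lemma shift_future_sources:
  "shift_source m i ` future_sources \<subseteq> sources"
  "past_sources m i \<inter> shift_source m i ` future_sources = {}"
proof -
  have *: "shift_source m i s \<in> sources - past_sources m i" if "s \<in> future_sources" for s
    using that by (cases s) (auto simp: past_sources_def future_sources_def)
  show "shift_source m i ` future_sources \<subseteq> sources"
    "past_sources m i \<inter> shift_source m i ` future_sources = {}"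
    using * by auto
qed

text \<open>Here m is deterministic, so independence of fixed source blocks applies. The random
  index is substituted only after the paths have been split by its value.\<close>

definition future :: "'a waypoint_queue \<Rightarrow> nat \<Rightarrow> nat \<Rightarrow> 'a \<Rightarrow> source \<Rightarrow> real" where
  "future R m i \<omega> = (\<lambda>s\<in>future_sources. source_var R (shift_source m i s) \<omega>)"

definition with_initial_time :: "real \<Rightarrow> (source \<Rightarrow> real) \<Rightarrow> source \<Rightarrow> real" where
  "with_initial_time t x = (\<lambda>s\<in>sources. if s = Init then t else x s)"

lemma restarted_eq:
  "restarted R i \<omega> = with_initial_time (system_time R i \<omega>) (future R (polled_index R i \<omega>) i \<omega>)"
  by (auto simp: restarted_def with_initial_time_def future_def future_sources_def fun_eq_iff)

lemma measurable_with_initial_time [measurable]: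
  "(\<lambda>(t, x). with_initial_time t x)
    \<in> measurable (borel \<Otimes>\<^sub>M PiM future_sources (\<lambda>_. borel)) (PiM sources (\<lambda>_. borel))"
  unfolding with_initial_time_def case_prod_beta
proof (rule measurable_restrict)
  fix s assume "s \<in> sources"
  show "(\<lambda>x. if s = Init then fst x else snd x s)
    \<in> borel_measurable (borel \<Otimes>\<^sub>M PiM future_sources (\<lambda>_. borel))"
    using \<open>s \<in> sources\<close>
    by (cases "s = Init") (auto simp: future_sources_def)
qed

text \<open>Padding lets functionals of \<open>coordinate_queue\<close>, which expect a full path,
  be applied to a block of sources. The default 1 decodes as a polled waypoint.\<close>

definition extend_sources :: "source set \<Rightarrow> (source \<Rightarrow> real) \<Rightarrow> source \<Rightarrow> real" where
  "extend_sources A x = (\<lambda>s\<in>sources. if s \<in> A then x s else 1)"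

lemma measurable_extend_sources [measurable]:
  "extend_sources A \<in> measurable (PiM A (\<lambda>_. borel)) (PiM sources (\<lambda>_. borel))"
  unfolding extend_sources_def
proof (rule measurable_restrict)
  fix s
  show "(\<lambda>x. if s \<in> A then x s else 1) \<in> borel_measurable (PiM A (\<lambda>_. borel))"
    by (cases "s \<in> A") auto
qed

text \<open>
  Outside the past the extension polls every update, so that it too has infinitely many of them
  and \<open>LEAST\<close> never ranges over an empty predicate.
\<close>

lemma extend_past_queue:
  fixes R :: "'a waypoint_queue" and \<omega> :: 'a and m i :: nat
  assumes inf: "\<forall>n. \<exists>k>n. polled R k \<omega>"
  defines "y \<equiv> extend_sources (past_sources m i) (\<lambda>s\<in>past_sources m i. source_var R s \<omega>)"
  shows "polled_index coordinate_queue i y = m \<longleftrightarrow> polled_index R i \<omega> = m"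
    and "polled_index R i \<omega> = m \<Longrightarrow> system_time coordinate_queue i y = system_time R i \<omega>"
proof -
  have inf': "\<forall>n. \<exists>k>n. polled coordinate_queue k y"
  proof
    fix n
    \<comment> \<open>This waypoint lies beyond the block {1..m}, hence carries the default
      1.\<close>
    have "polled coordinate_queue (Suc (max n m)) y"
      by (auto simp: y_def extend_sources_def past_sources_def)
    then show "\<exists>k>n. polled coordinate_queue k y"
      by (intro exI[of _ "Suc (max n m)"] conjI) (simp_all add: less_Suc_eq_le)
  qed
  have eq: "initial_time R \<omega> = initial_time coordinate_queue y"
    "n \<in> {1..m} \<Longrightarrow> hop R n \<omega> = hop coordinate_queue n y"
    "n \<in> {1..m} \<Longrightarrow> polled R n \<omega> = polled coordinate_queue n y"
    "j \<in> {1..i} \<Longrightarrow> service R j \<omega> = service coordinate_queue j y" for n j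
    by (auto simp: y_def extend_sources_def past_sources_def)
  have 1: "polled_index coordinate_queue i y = m \<and> system_time coordinate_queue i y = system_time R i \<omega>"
    if "polled_index R i \<omega> = m"
    using queue_local[OF inf inf' that eq order.refl] that by simp
  \<comment> \<open>Locality is applied a second time with the roles exchanged, since the padded
    index must equal m only on the right event.\<close>
  moreover have "polled_index R i \<omega> = m" if "polled_index coordinate_queue i y = m"
    using queue_local[OF inf' inf that eq[symmetric] order.refl] that by simp
  ultimately show "polled_index coordinate_queue i y = m \<longleftrightarrow> polled_index R i \<omega> = m"
    and "polled_index R i \<omega> = m \<Longrightarrow> system_time coordinate_queue i y = system_time R i \<omega>"
    by blast+
qed

section \<open>Strong Markov property at polled waypoints\<close>

context mm1_waypoint_queue
begin

lemma measurable_future [measurable]: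
  "future R m i \<in> measurable M (PiM future_sources (\<lambda>_. borel))"
  unfolding future_def
  by (intro measurable_restrict random_source) (use shift_future_sources(1) in auto)

lemma distr_source_shift:
  assumes "s \<in> future_sources"
  shows "distr M borel (source_var R (shift_source m i s)) = distr M borel (source_var R s)"
proof (cases s)
  case Init
  then show ?thesis by simp
next
  case (Hop n)
  then have "n \<noteq> 0" using assms by (simp add: future_sources_def)
  then show ?thesis
    using distributed_distr_eq_density[OF distributed_hop[of n]]
      distributed_distr_eq_density[OF distributed_hop[of "m + n"]] Hop
    by (simp cong: distr_cong)
next
  case (Serv n)
  then have "n \<noteq> 0" using assms by (simp add: future_sources_def)
  then show ?thesis
    using distributed_distr_eq_density[OF distributed_service[of n]]
      distributed_distr_eq_density[OF distributed_service[of "i + n"]] Serv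
    by (simp cong: distr_cong)
next
  case (Poll n)
  then have n: "n \<noteq> 0" "m + n \<noteq> 0" using assms by (simp_all add: future_sources_def)
  \<comment> \<open>Polling indicators have no density; their common law is the two-point measure
    with mass 1-p at 0 and p at 1.\<close>
  have "emeasure (distr M borel (source_var R (Poll k))) A
      = ennreal (of_bool (0 \<in> A) * (1 - p) + of_bool (1 \<in> A) * p)"
    if "A \<in> sets borel" "k \<noteq> 0" for A k
  proof -
    have E: "{\<omega> \<in> space M. polled R k \<omega>} \<in> events" "{\<omega> \<in> space M. \<not> polled R k \<omega>} \<in> events"
      using measurable_source(2)[OF that(2)] by simp_all
    have "source_var R (Poll k) -` A \<inter> space M
        = (if 0 \<in> A then {\<omega> \<in> space M. \<not> polled R k \<omega>} else {})
          \<union> (if 1 \<in> A then {\<omega> \<in> space M. polled R k \<omega>} else {})"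
      by (auto simp: of_bool_def split: if_splits)
    moreover have "prob ({\<omega> \<in> space M. \<not> polled R k \<omega>} \<union> {\<omega> \<in> space M. polled R k \<omega>}) = (1 - p) + p"
      using prob_polled[OF that(2)] prob_not_polled[OF that(2)] E
      by (subst finite_measure_Union) auto
    ultimately have "prob (source_var R (Poll k) -` A \<inter> space M)
      = of_bool (0 \<in> A) * (1 - p) + of_bool (1 \<in> A) * p"
      using prob_polled[OF that(2)] prob_not_polled[OF that(2)]
      by (simp del: source_var.simps)
    then show ?thesis
      using that random_source[of "Poll k"] by (simp add: emeasure_distr emeasure_eq_measure)
  qed
  with n show ?thesis
    unfolding Poll by (intro measure_eqI) (simp_all del: source_var.simps)
qed

text \<open>The shifted sources are again independent with the same marginals. The joint law is thus
  a product measure in which neither m nor i occurs, and this lets the pieces of the partition be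
  recombined.\<close>

lemma distr_future:
  "distr M (PiM future_sources (\<lambda>_. borel)) (future R m i)
    = PiM future_sources (\<lambda>s. distr M borel (source_var R s))"
proof -
  have ne: "future_sources \<noteq> {}"
    using sources_simps(2)[of 1] by (auto simp: future_sources_def simp del: sources_simps)
  have ind: "indep_vars (\<lambda>_. borel) (\<lambda>s. source_var R (shift_source m i s)) future_sources"
    by (rule indep_vars_reindex_inj[OF indep_sources])
      (use inj_shift_source shift_future_sources(1) in \<open>auto intro: inj_on_subset\<close>)
  have "distr M (PiM future_sources (\<lambda>_. borel)) (future R m i)
    = PiM future_sources (\<lambda>s. distr M borel (source_var R (shift_source m i s)))"
    unfolding future_def
    by (subst indep_vars_iff_distr_eq_PiM'[OF ne, symmetric])
      (use ind shift_future_sources(1) in \<open>auto intro!: random_source\<close>)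
  also have "\<dots> = PiM future_sources (\<lambda>s. distr M borel (source_var R s))"
    by (intro PiM_cong refl distr_source_shift)
  finally show ?thesis .
qed

text \<open>On the event that the index is m, the system time is a function of
  \<open>past_sources m i\<close>, and so is the event itself; the future reads a disjoint block.
  Independence then decouples the two for each fixed m.\<close>

lemma nn_integral_past_future:
  assumes F [measurable]: "F \<in> borel_measurable (borel \<Otimes>\<^sub>M PiM future_sources (\<lambda>_. borel))"
  shows "(\<integral>\<^sup>+\<omega>. of_bool (polled_index R i \<omega> = m) * F (system_time R i \<omega>, future R m i \<omega>) \<partial>M)
    = (\<integral>\<^sup>+\<omega>'. (\<integral>\<^sup>+\<omega>. of_bool (polled_index R i \<omega> = m) * F (system_time R i \<omega>, future R m i \<omega>') \<partial>M) \<partial>M)"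
proof -
  interpret C: measurable_waypoint_queue "PiM sources (\<lambda>_. borel)" coordinate_queue
    by (rule measurable_coordinate_queue)
  let ?P = "\<lambda>\<omega>. \<lambda>s\<in>past_sources m i. source_var R s \<omega>"
  let ?G = "\<lambda>(x, y). of_bool (polled_index coordinate_queue i (extend_sources (past_sources m i) x) = m)
    * F (system_time coordinate_queue i (extend_sources (past_sources m i) x), y)"
  have G [measurable]: "?G \<in> borel_measurable (PiM (past_sources m i) (\<lambda>_. borel) \<Otimes>\<^sub>M PiM future_sources (\<lambda>_. borel))"
    by measurable
  have "indep_var (PiM (past_sources m i) (\<lambda>_. borel)) ?P
      (PiM (shift_source m i ` future_sources) (\<lambda>_. borel))
      (\<lambda>\<omega>. \<lambda>s\<in>shift_source m i ` future_sources. source_var R s \<omega>)"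
    by (rule indep_var_restrict[OF indep_sources shift_future_sources(2) past_sources_subset
          shift_future_sources(1)])
  \<comment> \<open>Reading the shifted block through \<open>shift_source\<close> renames its
    coordinates, so that the index set of the future no longer mentions m and i.\<close>
  then have "indep_var (PiM (past_sources m i) (\<lambda>_. borel)) (id \<circ> ?P)
      (PiM future_sources (\<lambda>_. borel))
      ((\<lambda>x. \<lambda>s\<in>future_sources. x (shift_source m i s)) \<circ>
        (\<lambda>\<omega>. \<lambda>s\<in>shift_source m i ` future_sources. source_var R s \<omega>))"
    by (rule indep_var_compose) (auto intro!: measurable_restrict)
  moreover have "(\<lambda>x. \<lambda>s\<in>future_sources. x (shift_source m i s)) \<circ>
        (\<lambda>\<omega>. \<lambda>s\<in>shift_source m i ` future_sources. source_var R s \<omega>) = future R m i"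
    by (auto simp: future_def fun_eq_iff)
  ultimately have ind: "indep_var (PiM (past_sources m i) (\<lambda>_. borel)) ?P
      (PiM future_sources (\<lambda>_. borel)) (future R m i)"
    by simp
  \<comment> \<open>The exceptional set must not depend on y, because y will be the future of a
    different sample point.\<close>
  have AE: "AE \<omega> in M. \<forall>y. ?G (?P \<omega>, y)
      = of_bool (polled_index R i \<omega> = m) * F (system_time R i \<omega>, y)"
    using AE_infinitely_polled
    by eventually_elim (auto simp: extend_past_queue)
  have "(\<integral>\<^sup>+\<omega>. of_bool (polled_index R i \<omega> = m) * F (system_time R i \<omega>, future R m i \<omega>) \<partial>M)
      = (\<integral>\<^sup>+\<omega>. ?G (?P \<omega>, future R m i \<omega>) \<partial>M)"
    by (rule nn_integral_cong_AE) (use AE in eventually_elim, simp)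
  also have "\<dots> = (\<integral>\<^sup>+\<omega>'. (\<integral>\<^sup>+\<omega>. ?G (?P \<omega>, future R m i \<omega>') \<partial>M) \<partial>M)"
    by (rule nn_integral_indep_var[OF ind G])
  also have "\<dots> = (\<integral>\<^sup>+\<omega>'. (\<integral>\<^sup>+\<omega>. of_bool (polled_index R i \<omega> = m)
      * F (system_time R i \<omega>, future R m i \<omega>') \<partial>M) \<partial>M)"
    by (rule nn_integral_cong, rule nn_integral_cong_AE) (use AE in eventually_elim, simp)
  finally show ?thesis .
qed

text \<open>The future after the random waypoint is a fresh copy of the sources, independent of the
  system time there. Splitting by m replaces the random index by a constant; since the law of the
  future is the same for all m, the indicators sum back to 1.\<close>

lemma nn_integral_renewal:
  assumes F [measurable]: "F \<in> borel_measurable (borel \<Otimes>\<^sub>M PiM future_sources (\<lambda>_. borel))"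
  shows "(\<integral>\<^sup>+\<omega>. F (system_time R i \<omega>, future R (polled_index R i \<omega>) i \<omega>) \<partial>M)
    = (\<integral>\<^sup>+y. (\<integral>\<^sup>+t. F (t, y) \<partial>distr M borel (system_time R i))
        \<partial>PiM future_sources (\<lambda>s. distr M borel (source_var R s)))"
    (is "?L = (\<integral>\<^sup>+y. _ \<partial>?D)")
proof -
  have sets_D [measurable_cong]: "sets ?D = sets (PiM future_sources (\<lambda>_. borel))"
    by (intro sets_PiM_cong) simp_all
  have "?L = (\<integral>\<^sup>+\<omega>. (\<Sum>m. of_bool (polled_index R i \<omega> = m) * F (system_time R i \<omega>, future R m i \<omega>)) \<partial>M)"
    by (simp only: suminf_of_bool_eq)
  also have "\<dots> = (\<Sum>m. \<integral>\<^sup>+\<omega>. of_bool (polled_index R i \<omega> = m) * F (system_time R i \<omega>, future R m i \<omega>) \<partial>M)"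
    by (rule nn_integral_suminf) measurable
  also have "\<dots> = (\<Sum>m. \<integral>\<^sup>+\<omega>'. (\<integral>\<^sup>+\<omega>. of_bool (polled_index R i \<omega> = m)
      * F (system_time R i \<omega>, future R m i \<omega>') \<partial>M) \<partial>M)"
    by (simp only: nn_integral_past_future[OF F])
  also have "\<dots> = (\<Sum>m. \<integral>\<^sup>+y. (\<integral>\<^sup>+\<omega>. of_bool (polled_index R i \<omega> = m)
      * F (system_time R i \<omega>, y) \<partial>M) \<partial>?D)"
  proof (intro arg_cong[where f = suminf] ext)
    fix m
    have [measurable]: "(\<lambda>y. \<integral>\<^sup>+\<omega>. of_bool (polled_index R i \<omega> = m) * F (system_time R i \<omega>, y) \<partial>M)
        \<in> borel_measurable (PiM future_sources (\<lambda>_. borel))"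
      by measurable
    show "(\<integral>\<^sup>+\<omega>'. (\<integral>\<^sup>+\<omega>. of_bool (polled_index R i \<omega> = m) * F (system_time R i \<omega>, future R m i \<omega>') \<partial>M) \<partial>M)
        = (\<integral>\<^sup>+y. (\<integral>\<^sup>+\<omega>. of_bool (polled_index R i \<omega> = m) * F (system_time R i \<omega>, y) \<partial>M) \<partial>?D)"
      unfolding distr_future[of m i, symmetric] by (subst nn_integral_distr) simp_all
  qed
  also have "\<dots> = (\<integral>\<^sup>+y. (\<Sum>m. \<integral>\<^sup>+\<omega>. of_bool (polled_index R i \<omega> = m) * F (system_time R i \<omega>, y) \<partial>M) \<partial>?D)"
    by (rule nn_integral_suminf[symmetric]) measurable
  also have "\<dots> = (\<integral>\<^sup>+y. (\<integral>\<^sup>+\<omega>. F (system_time R i \<omega>, y) \<partial>M) \<partial>?D)"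
  proof (intro nn_integral_cong)
    fix y assume "y \<in> space ?D"
    then have y [measurable]: "y \<in> space (PiM future_sources (\<lambda>_. borel))"
      using sets_eq_imp_space_eq[OF sets_D] by simp
    have [measurable]: "(\<lambda>t. F (t, y)) \<in> borel_measurable borel"
      using y by measurable
    have "(\<Sum>m. \<integral>\<^sup>+\<omega>. of_bool (polled_index R i \<omega> = m) * F (system_time R i \<omega>, y) \<partial>M)
      = (\<integral>\<^sup>+\<omega>. (\<Sum>m. of_bool (polled_index R i \<omega> = m) * F (system_time R i \<omega>, y)) \<partial>M)"
      by (rule nn_integral_suminf[symmetric]) measurable
    then show "(\<Sum>m. \<integral>\<^sup>+\<omega>. of_bool (polled_index R i \<omega> = m) * F (system_time R i \<omega>, y) \<partial>M)
      = (\<integral>\<^sup>+\<omega>. F (system_time R i \<omega>, y) \<partial>M)"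
      by (simp only: suminf_of_bool_eq)
  qed
  also have "\<dots> = (\<integral>\<^sup>+y. (\<integral>\<^sup>+t. F (t, y) \<partial>distr M borel (system_time R i)) \<partial>?D)"
  proof (intro nn_integral_cong)
    fix y assume "y \<in> space ?D"
    then have y [measurable]: "y \<in> space (PiM future_sources (\<lambda>_. borel))"
      using sets_eq_imp_space_eq[OF sets_D] by simp
    have [measurable]: "(\<lambda>t. F (t, y)) \<in> borel_measurable borel"
      using y by measurable
    show "(\<integral>\<^sup>+\<omega>. F (system_time R i \<omega>, y) \<partial>M) = (\<integral>\<^sup>+t. F (t, y) \<partial>distr M borel (system_time R i))"
      by (subst nn_integral_distr) simp_all
  qed
  finally show ?thesis .
qed

lemma measurable_restarted [measurable]:
  "restarted R i \<in> measurable M (PiM sources (\<lambda>_. borel))"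
proof -
  have "(\<lambda>\<omega>. (\<lambda>(t, x). with_initial_time t x) (system_time R i \<omega>, future R m i \<omega>))
    \<in> measurable M (PiM sources (\<lambda>_. borel))" for m
    by measurable
  then have *: "(\<lambda>\<omega>. with_initial_time (system_time R i \<omega>) (future R m i \<omega>))
    \<in> measurable M (PiM sources (\<lambda>_. borel))" for m
    by simp
  have "restarted R i = (\<lambda>\<omega>. with_initial_time (system_time R i \<omega>) (future R (polled_index R i \<omega>) i \<omega>))"
    by (rule ext) (rule restarted_eq)
  with measurable_compose_countable[where
      f = "\<lambda>m \<omega>. with_initial_time (system_time R i \<omega>) (future R m i \<omega>)", OF * measurable_polled_index]
  show ?thesis by simp
qed

text \<open>In the renewal formula the index i enters only through the law of the system time.
  Applying the formula to indicator functions gives equality of the measures.\<close>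

lemma distr_restarted:
  assumes "distr M borel (system_time R i) = distr M borel (system_time R j)"
  shows "distr M (PiM sources (\<lambda>_. borel)) (restarted R i)
    = distr M (PiM sources (\<lambda>_. borel)) (restarted R j)"
proof (rule measure_eqI)
  fix A assume "A \<in> sets (distr M (PiM sources (\<lambda>_. borel)) (restarted R i))"
  then have A [measurable]: "A \<in> sets (PiM sources (\<lambda>_. borel))" by simp
  let ?F = "\<lambda>z. indicator A ((\<lambda>(t, x). with_initial_time t x) z) :: ennreal"
  have F: "?F \<in> borel_measurable (borel \<Otimes>\<^sub>M PiM future_sources (\<lambda>_. borel))"
    by measurable
  have "emeasure (distr M (PiM sources (\<lambda>_. borel)) (restarted R k)) A
      = (\<integral>\<^sup>+\<omega>. ?F (system_time R k \<omega>, future R (polled_index R k \<omega>) k \<omega>) \<partial>M)" for k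
    by (simp add: nn_integral_indicator[symmetric] nn_integral_distr restarted_eq[symmetric]
        del: nn_integral_indicator)
  then show "emeasure (distr M (PiM sources (\<lambda>_. borel)) (restarted R i)) A
      = emeasure (distr M (PiM sources (\<lambda>_. borel)) (restarted R j)) A"
    by (simp only: nn_integral_renewal[OF F] assms)
qed simp

text \<open>Both expectations integrate one measurable functional on path space against the same
  law, so their equality requires no integrability of \<open>Q\<close>.\<close>

lemma expectation_Q_stationary:
  assumes "steady_state M R"
  shows "expectation (Q R v (Suc i)) = expectation (Q R v (Suc 0))"
proof -
  interpret C: measurable_waypoint_queue "PiM sources (\<lambda>_. borel)" coordinate_queue
    by (rule measurable_coordinate_queue)
  have "expectation (Q R v (Suc k))
      = integral\<^sup>L (distr M (PiM sources (\<lambda>_. borel)) (restarted R k)) (Q coordinate_queue v (Suc 0))" for k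
  proof -
    have "AE \<omega> in M. Q R v (Suc k) \<omega> = Q coordinate_queue v (Suc 0) (restarted R k \<omega>)"
      using AE_infinitely_polled by eventually_elim (rule restarted_Q)
    then have "expectation (Q R v (Suc k)) = expectation (\<lambda>\<omega>. Q coordinate_queue v (Suc 0) (restarted R k \<omega>))"
      by (intro integral_cong_AE) measurable
    then show ?thesis by (simp add: integral_distr)
  qed
  moreover have "distr M borel (system_time R i) = distr M borel (system_time R 0)"
    using assms by (simp add: steady_state_def)
  ultimately show ?thesis
    using distr_restarted[of i 0] by simp
qed

end

section \<open>The first polling interval\<close>

text \<open>The complement of the polls: the number of hops is a function of the polls alone and is
  therefore independent of this block.\<close>

definition duration_sources :: "source set" where
  "duration_sources = sources - range Poll"

context mm1_waypoint_queue
begin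

definition durations :: "'a \<Rightarrow> source \<Rightarrow> real" where
  "durations \<omega> = (\<lambda>s\<in>duration_sources. source_var R s \<omega>)"

lemma measurable_durations [measurable]:
  "durations \<in> measurable M (PiM duration_sources (\<lambda>_. borel))"
  unfolding durations_def by (intro measurable_restrict random_source) (simp add: duration_sources_def)

text \<open>Rewrites the outcome of an unbounded search as a finite pattern, n failures followed by
  a success, whose probability is a product.\<close>

lemma first_hop_count_eq_iff:
  assumes "\<forall>n. \<exists>k>n. polled R k \<omega>"
  shows "hop_count R (Suc 0) \<omega> = Suc n \<longleftrightarrow> (\<forall>k\<in>{1..Suc n}. polled R k \<omega> = (k = Suc n))"
proof -
  let ?N = "LEAST n. 0 < n \<and> polled R n \<omega>"
  have N: "0 < ?N \<and> polled R ?N \<omega>"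
    by (rule LeastI_ex) (use assms in blast)
  have least: "\<not> polled R k \<omega>" if "0 < k" "k < ?N" for k
    using not_less_Least[OF that(2)] that(1) by simp
  have "?N = Suc n \<longleftrightarrow> (\<forall>k\<in>{1..Suc n}. polled R k \<omega> = (k = Suc n))"
  proof
    assume *: "?N = Suc n"
    show "\<forall>k\<in>{1..Suc n}. polled R k \<omega> = (k = Suc n)"
    proof
      fix k assume "k \<in> {1..Suc n}"
      then show "polled R k \<omega> = (k = Suc n)"
        using N least[of k] unfolding * by (cases "k = Suc n") auto
    qed
  next
    assume *: "\<forall>k\<in>{1..Suc n}. polled R k \<omega> = (k = Suc n)"
    then show "?N = Suc n"
      by (intro Least_equality) (auto simp: not_less_eq_eq Ball_def intro: ccontr)
  qed
  then show ?thesis by (simp add: hop_count_def)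
qed

lemma first_hop_count_pos:
  assumes "\<forall>n. \<exists>k>n. polled R k \<omega>"
  shows "0 < hop_count R (Suc 0) \<omega>"
  using polled_index_step(1)[OF assms, of 0] by (simp add: hop_count_def)

text \<open>Conditioning on k = n+1, with the geometric weight p(1-p)^n. The integrand may depend on
  k as well; for each n the pattern reads only polls, so its indicator splits off by
  independence.\<close>

lemma nn_integral_first_hop_count:
  assumes f [measurable]: "\<And>n. f n \<in> borel_measurable (PiM duration_sources (\<lambda>_. borel))"
  shows "(\<integral>\<^sup>+\<omega>. f (hop_count R (Suc 0) \<omega>) (durations \<omega>) \<partial>M)
    = (\<Sum>n. ennreal (p * (1 - p) ^ n) * (\<integral>\<^sup>+\<omega>. f (Suc n) (durations \<omega>) \<partial>M))"
proof -
  let ?pat = "\<lambda>n \<omega>. \<forall>k\<in>{1..Suc n}. polled R k \<omega> = (k = Suc n)"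
  have pat_event: "{\<omega> \<in> space M. ?pat n \<omega>} \<in> events" for n
  proof -
    have "Measurable.pred M (?pat n)"
      by (intro pred_intros_finite) (auto intro!: measurable_source)
    then show ?thesis by simp
  qed
  have prob_pat: "prob {\<omega> \<in> space M. ?pat n \<omega>} = p * (1 - p) ^ n" for n
  proof -
    have "prob {\<omega> \<in> space M. ?pat n \<omega>} = (\<Prod>k\<in>{1..Suc n}. if k = Suc n then p else 1 - p)"
      by (rule prob_polling_pattern) auto
    also have "\<dots> = p * (\<Prod>k\<in>{1..n}. 1 - p)"
      by (subst prod.nat_ivl_Suc') (auto intro!: arg_cong2[where f = "(*)"] prod.cong)
    finally show ?thesis by simp
  qed
  have pieces: "(\<integral>\<^sup>+\<omega>. of_bool (?pat n \<omega>) * f (Suc n) (durations \<omega>) \<partial>M)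
      = ennreal (p * (1 - p) ^ n) * (\<integral>\<^sup>+\<omega>. f (Suc n) (durations \<omega>) \<partial>M)" for n
  proof -
    let ?A = "Poll ` {1..Suc n}"
    let ?P = "\<lambda>\<omega>. \<lambda>s\<in>?A. source_var R s \<omega>"
    let ?G = "\<lambda>(x :: source \<Rightarrow> real, y). of_bool (\<forall>k\<in>{1..Suc n}. (x (Poll k) = 1) = (k = Suc n)) * f (Suc n) y"
    have ind: "indep_var (PiM ?A (\<lambda>_. borel)) ?P (PiM duration_sources (\<lambda>_. borel)) durations"
      unfolding durations_def
      by (rule indep_var_restrict[OF indep_sources]) (auto simp: duration_sources_def)
    have G: "?G \<in> borel_measurable (PiM ?A (\<lambda>_. borel) \<Otimes>\<^sub>M PiM duration_sources (\<lambda>_. borel))"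
    proof -
      have P: "Measurable.pred (PiM ?A (\<lambda>_. borel :: real measure))
          (\<lambda>x. \<forall>k\<in>{1..Suc n}. (x (Poll k) = 1) = (k = Suc n))"
        by (intro pred_intros_finite) auto
      have "(\<lambda>z. of_bool (P (fst z)) * g (snd z) :: ennreal)
          \<in> borel_measurable (PiM ?A (\<lambda>_. borel) \<Otimes>\<^sub>M PiM duration_sources (\<lambda>_. borel))"
        if [measurable]: "Measurable.pred (PiM ?A (\<lambda>_. borel)) P"
          "g \<in> borel_measurable (PiM duration_sources (\<lambda>_. borel))"
        for P :: "(source \<Rightarrow> real) \<Rightarrow> bool" and g
        by measurable
      from this[OF P f[of "Suc n"]] show ?thesis
        unfolding case_prod_beta .
    qed
    have "(\<integral>\<^sup>+\<omega>. of_bool (?pat n \<omega>) * f (Suc n) (durations \<omega>) \<partial>M)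
        = (\<integral>\<^sup>+\<omega>. ?G (?P \<omega>, durations \<omega>) \<partial>M)"
      by (intro nn_integral_cong) (simp add: Ball_def)
    also have "\<dots> = (\<integral>\<^sup>+\<omega>'. (\<integral>\<^sup>+\<omega>. ?G (?P \<omega>, durations \<omega>') \<partial>M) \<partial>M)"
      by (rule nn_integral_indep_var[OF ind G])
    also have "\<dots> = (\<integral>\<^sup>+\<omega>'. (\<integral>\<^sup>+\<omega>. f (Suc n) (durations \<omega>') * indicator {\<omega> \<in> space M. ?pat n \<omega>} \<omega> \<partial>M) \<partial>M)"
      by (intro nn_integral_cong) (auto simp: Ball_def split: split_indicator)
    also have "\<dots> = (\<integral>\<^sup>+\<omega>'. ennreal (p * (1 - p) ^ n) * f (Suc n) (durations \<omega>') \<partial>M)"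
      unfolding nn_integral_cmult_indicator[OF pat_event] emeasure_eq_measure prob_pat
      by (simp only: mult.commute)
    also have "\<dots> = ennreal (p * (1 - p) ^ n) * (\<integral>\<^sup>+\<omega>. f (Suc n) (durations \<omega>) \<partial>M)"
      by (rule nn_integral_cmult) measurable
    finally show ?thesis .
  qed
  have "(\<integral>\<^sup>+\<omega>. f (hop_count R (Suc 0) \<omega>) (durations \<omega>) \<partial>M)
      = (\<integral>\<^sup>+\<omega>. (\<Sum>n. of_bool (?pat n \<omega>) * f (Suc n) (durations \<omega>)) \<partial>M)"
  proof (rule nn_integral_cong_AE)
    show "AE \<omega> in M. f (hop_count R (Suc 0) \<omega>) (durations \<omega>)
        = (\<Sum>n. of_bool (?pat n \<omega>) * f (Suc n) (durations \<omega>))"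
      using AE_infinitely_polled
    proof eventually_elim
      fix \<omega> assume inf: "\<forall>n. \<exists>k>n. polled R k \<omega>"
      obtain N where N: "hop_count R (Suc 0) \<omega> = Suc N"
        using first_hop_count_pos[OF inf] gr0_conv_Suc by blast
      have "?pat n \<omega> \<longleftrightarrow> N = n" for n
        using first_hop_count_eq_iff[OF inf, of n] N by simp
      then show "f (hop_count R (Suc 0) \<omega>) (durations \<omega>)
        = (\<Sum>n. of_bool (?pat n \<omega>) * f (Suc n) (durations \<omega>))"
        by (simp only: suminf_of_bool_eq N)
    qed
  qed
  also have "\<dots> = (\<Sum>n. \<integral>\<^sup>+\<omega>. of_bool (?pat n \<omega>) * f (Suc n) (durations \<omega>) \<partial>M)"
  proof (rule nn_integral_suminf)
    fix n
    have "Measurable.pred M (?pat n)"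
      using pat_event[of n] by simp
    note [measurable] = this
    show "(\<lambda>\<omega>. of_bool (?pat n \<omega>) * f (Suc n) (durations \<omega>)) \<in> borel_measurable M"
      by measurable
  qed
  finally show ?thesis by (simp only: pieces)
qed

section \<open>Law of the first polling interval and of the initial time\<close>

lemma first_interarrival: "interarrival R (Suc 0) \<omega> = (\<Sum>j=1..hop_count R (Suc 0) \<omega>. hop R j \<omega>)"
  by (simp add: interarrival_def hop_duration_def)

lemma indep_hops:
  assumes "0 \<notin> A"
  shows "indep_vars (\<lambda>_. borel) (hop R) A"
proof -
  have "Hop ` A \<subseteq> sources"
    using assms by (metis image_subsetI sources_simps(2))
  then show ?thesis
    using indep_vars_reindex_inj[OF indep_sources, of Hop A] by (simp add: inj_on_def)
qed

text \<open>Given n+1 hops the interval has an Erlang law with shape index n, and the geometric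
  mixture of these densities is exponential. Testing on indicators allows sum and integral to be
  exchanged freely.\<close>

lemma distr_first_interarrival:
  "distr M borel (interarrival R (Suc 0)) = exponential_measure (p * lam)"
proof (rule measure_eqI)
  fix A assume "A \<in> sets (distr M borel (interarrival R (Suc 0)))"
  then have A [measurable]: "A \<in> sets borel" by simp
  have erlang: "(\<integral>\<^sup>+\<omega>. indicator A (\<Sum>j=1..Suc n. hop R j \<omega>) \<partial>M)
    = (\<integral>\<^sup>+x. ennreal (erlang_density n lam x) * indicator A x \<partial>lborel)" for n
  proof -
    have "distributed M lborel (\<lambda>\<omega>. \<Sum>j\<in>{1..Suc n}. hop R j \<omega>) (erlang_density (card {1..Suc n} - 1) lam)"
      by (rule exponential_distributed_sum) (auto intro!: distributed_hop indep_hops simp: rates)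
    then have D: "distributed M lborel (\<lambda>\<omega>. \<Sum>j=1..Suc n. hop R j \<omega>) (erlang_density n lam)"
      by simp
    show ?thesis
      using distributed_nn_integral[OF D, of "indicator A"] by simp
  qed
  have "emeasure (distr M borel (interarrival R (Suc 0))) A
      = (\<integral>\<^sup>+\<omega>. indicator A (interarrival R (Suc 0) \<omega>) \<partial>M)"
    by (simp add: nn_integral_indicator[symmetric] nn_integral_distr del: nn_integral_indicator)
  also have "\<dots> = (\<integral>\<^sup>+\<omega>. indicator A (\<Sum>j=1..hop_count R (Suc 0) \<omega>. durations \<omega> (Hop j)) \<partial>M)"
    by (intro nn_integral_cong arg_cong[where f = "indicator A"])
      (auto simp: first_interarrival durations_def duration_sources_def intro!: sum.cong)
  also have "\<dots> = (\<Sum>n. ennreal (p * (1 - p) ^ n)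
      * (\<integral>\<^sup>+\<omega>. indicator A (\<Sum>j=1..Suc n. durations \<omega> (Hop j)) \<partial>M))"
  proof (rule nn_integral_first_hop_count[where f = "\<lambda>n x. indicator A (\<Sum>j=1..n. x (Hop j))"])
    fix n
    have "(\<lambda>x. \<Sum>j=1..n. x (Hop j) :: real) \<in> borel_measurable (PiM duration_sources (\<lambda>_. borel))"
      by (intro borel_measurable_sum measurable_component_singleton) (auto simp: duration_sources_def)
    note [measurable] = this
    show "(\<lambda>x. indicator A (\<Sum>j=1..n. x (Hop j))) \<in> borel_measurable (PiM duration_sources (\<lambda>_. borel))"
      by measurable
  qed
  also have "\<dots> = (\<Sum>n. ennreal (p * (1 - p) ^ n) * (\<integral>\<^sup>+\<omega>. indicator A (\<Sum>j=1..Suc n. hop R j \<omega>) \<partial>M))"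
  proof -
    have "(\<Sum>j=1..Suc n. durations \<omega> (Hop j)) = (\<Sum>j=1..Suc n. hop R j \<omega>)" for n \<omega>
      by (intro sum.cong) (auto simp: durations_def duration_sources_def)
    then show ?thesis by simp
  qed
  also have "\<dots> = (\<Sum>n. \<integral>\<^sup>+x. ennreal (p * (1 - p) ^ n) * (ennreal (erlang_density n lam x) * indicator A x) \<partial>lborel)"
    unfolding erlang by (simp add: nn_integral_cmult)
  also have "\<dots> = (\<integral>\<^sup>+x. (\<Sum>n. ennreal (p * (1 - p) ^ n) * (ennreal (erlang_density n lam x) * indicator A x)) \<partial>lborel)"
    by (rule nn_integral_suminf[symmetric]) measurable
  also have "\<dots> = (\<integral>\<^sup>+x. ennreal (exponential_density (p * lam) x) * indicator A x \<partial>lborel)"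
  proof (intro nn_integral_cong)
    fix x :: real
    have "(\<Sum>n. ennreal (p * (1 - p) ^ n) * (ennreal (erlang_density n lam x) * indicator A x))
      = (\<Sum>n. ennreal (p * (1 - p) ^ n * erlang_density n lam x)) * indicator A x"
      using rates polling_prob
      by (simp add: ennreal_mult mult.assoc[symmetric] ennreal_suminf_multc)
    also have "(\<Sum>n. ennreal (p * (1 - p) ^ n * erlang_density n lam x)) = ennreal (exponential_density (p * lam) x)"
    proof (cases "0 \<le> x")
      case True
      then show ?thesis
        using rates polling_prob
        by (intro suminf_ennreal_eq sums_geometric_erlang) auto
    next
      case False
      then show ?thesis by (simp add: erlang_density_def)
    qed
    finally show "(\<Sum>n. ennreal (p * (1 - p) ^ n) * (ennreal (erlang_density n lam x) * indicator A x))
      = ennreal (exponential_density (p * lam) x) * indicator A x" .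
  qed
  also have "\<dots> = emeasure (exponential_measure (p * lam)) A"
    by (simp add: emeasure_density)
  finally show "emeasure (distr M borel (interarrival R (Suc 0))) A = emeasure (exponential_measure (p * lam)) A" .
qed simp

text \<open>Independence for functionals of full paths: each is evaluated on a padded vector that
  carries only its own block, and disjoint blocks are independent. The padding is removed afterwards
  by showing that the functional reads nothing outside its block.\<close>

lemma indep_var_sources:
  assumes "A \<inter> B = {}" "A \<subseteq> sources" "B \<subseteq> sources"
    and "f \<in> measurable (PiM sources (\<lambda>_. borel)) N" "g \<in> measurable (PiM sources (\<lambda>_. borel)) N'"
  shows "indep_var N (\<lambda>\<omega>. f (extend_sources A (\<lambda>s\<in>A. source_var R s \<omega>)))
    N' (\<lambda>\<omega>. g (extend_sources B (\<lambda>s\<in>B. source_var R s \<omega>)))"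
  using indep_var_compose[OF indep_var_restrict[OF indep_sources assms(1-3)]
      measurable_compose[OF measurable_extend_sources assms(4)]
      measurable_compose[OF measurable_extend_sources assms(5)]]
  by (simp add: comp_def)

text \<open>The predicates under the two \<open>LEAST\<close> operators coincide as functions, so
  the identity holds for every \<omega>, even when the search fails.\<close>

lemma extend_sources_first_interarrival:
  assumes "\<And>n. n \<noteq> 0 \<Longrightarrow> Hop n \<in> A \<and> Poll n \<in> A"
  shows "interarrival coordinate_queue (Suc 0) (extend_sources A (\<lambda>s\<in>A. source_var R s \<omega>))
    = interarrival R (Suc 0) \<omega>"
proof -
  let ?y = "extend_sources A (\<lambda>s\<in>A. source_var R s \<omega>)"
  have "(\<lambda>n. 0 < n \<and> polled coordinate_queue n ?y) = (\<lambda>n. 0 < n \<and> polled R n \<omega>)"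
    using assms by (auto simp: extend_sources_def)
  then have "hop_count coordinate_queue (Suc 0) ?y = hop_count R (Suc 0) \<omega>"
    unfolding hop_count_def by simp
  then show ?thesis
    using assms by (auto simp: interarrival_def hop_duration_def extend_sources_def intro!: sum.cong)
qed

lemma distr_initial_time:
  assumes "p * lam < \<mu>" and stat: "steady_state M R"
  shows "distr M borel (initial_time R) = exponential_measure (\<mu> - p * lam)"
proof (rule stationary_system_time_exponential)
  interpret C: measurable_waypoint_queue "PiM sources (\<lambda>_. borel)" coordinate_queue
    by (rule measurable_coordinate_queue)
  show "0 < p * lam" "p * lam < \<mu>"
    using rates polling_prob assms(1) by simp_all
  show "distr M borel (interarrival R (Suc 0)) = exponential_measure (p * lam)"
    by (rule distr_first_interarrival)
  show S: "distr M borel (service R (Suc 0)) = exponential_measure \<mu>"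
    using distributed_service[of "Suc 0"] by (subst distributed_exponential_iff[symmetric]) auto
  have T1: "system_time R (Suc 0) = (\<lambda>\<omega>. max 0 (initial_time R \<omega> - interarrival R (Suc 0) \<omega>) + service R (Suc 0) \<omega>)"
    by (rule ext) simp
  have T0: "system_time R 0 = initial_time R"
    by (rule ext) simp
  have "distr M borel (system_time R (Suc 0)) = distr M borel (system_time R 0)"
    using stat unfolding steady_state_def by blast
  then show stat1: "distr M borel (\<lambda>\<omega>. max 0 (initial_time R \<omega> - interarrival R (Suc 0) \<omega>) + service R (Suc 0) \<omega>)
      = distr M borel (initial_time R)"
    unfolding T0 T1 .
  \<comment> \<open>The system time of update 1 is at least its service time, hence nonnegative;
    \<open>initial_time\<close> has the same law and inherits the sign.\<close>
  have "AE \<omega> in M. 0 \<le> service R (Suc 0) \<omega>"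
    by (subst distributed_AE2[OF distributed_service[of "Suc 0"]]) (auto simp: exponential_density_def)
  then have "AE \<omega> in M. 0 \<le> max 0 (initial_time R \<omega> - interarrival R (Suc 0) \<omega>) + service R (Suc 0) \<omega>"
    by eventually_elim auto
  then have "AE t in distr M borel (\<lambda>\<omega>. max 0 (initial_time R \<omega> - interarrival R (Suc 0) \<omega>) + service R (Suc 0) \<omega>). 0 \<le> t"
    by (subst AE_distr_iff) auto
  then show "AE \<omega> in M. 0 \<le> initial_time R \<omega>"
    unfolding stat1 by (subst (asm) AE_distr_iff) auto
  have "indep_var borel (\<lambda>\<omega>. initial_time coordinate_queue (extend_sources {Init} (\<lambda>s\<in>{Init}. source_var R s \<omega>)))
      borel (\<lambda>\<omega>. interarrival coordinate_queue (Suc 0)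
        (extend_sources (sources - {Init}) (\<lambda>s\<in>sources - {Init}. source_var R s \<omega>)))"
    by (rule indep_var_sources) (auto intro!: C.measurable_source C.measurable_interarrival)
  then show "indep_var borel (initial_time R) borel (interarrival R (Suc 0))"
    by (subst (asm) extend_sources_first_interarrival) (auto simp: extend_sources_def)
  \<comment> \<open>The waiting time of update 1 depends on no service time of positive index, so
    all sources except \<open>Serv 1\<close> may go into its block.\<close>
  let ?A = "sources - {Serv (Suc 0)}"
  have "indep_var borel (\<lambda>\<omega>. (\<lambda>y. max 0 (initial_time coordinate_queue y - interarrival coordinate_queue (Suc 0) y))
        (extend_sources ?A (\<lambda>s\<in>?A. source_var R s \<omega>)))
      borel (\<lambda>\<omega>. service coordinate_queue (Suc 0)
        (extend_sources {Serv (Suc 0)} (\<lambda>s\<in>{Serv (Suc 0)}. source_var R s \<omega>)))"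
  proof (rule indep_var_sources)
    show "(\<lambda>y. max 0 (initial_time coordinate_queue y - interarrival coordinate_queue (Suc 0) y))
      \<in> borel_measurable (PiM sources (\<lambda>_. borel))"
      using C.measurable_source(4) C.measurable_interarrival by measurable
  qed (auto intro!: C.measurable_source)
  then show "indep_var borel (\<lambda>\<omega>. max 0 (initial_time R \<omega> - interarrival R (Suc 0) \<omega>)) borel (service R (Suc 0))"
    by (subst (asm) extend_sources_first_interarrival) (auto simp: extend_sources_def)
qed

section \<open>Moments of hops, service and waiting time\<close>

lemma AE_hop_nonneg: "AE \<omega> in M. \<forall>n. n \<noteq> 0 \<longrightarrow> 0 \<le> hop R n \<omega>"
  unfolding AE_all_countable
proof
  fix n
  show "AE \<omega> in M. n \<noteq> 0 \<longrightarrow> 0 \<le> hop R n \<omega>"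
    by (cases "n = 0", simp)
      (subst distributed_AE2[OF distributed_hop[of n]], auto simp: exponential_density_def)
qed

lemma AE_service_nonneg: "n \<noteq> 0 \<Longrightarrow> AE \<omega> in M. 0 \<le> service R n \<omega>"
  by (subst distributed_AE2[OF distributed_service[of n]]) (auto simp: exponential_density_def)

lemma hop_moment:
  "n \<noteq> 0 \<Longrightarrow> has_bochner_integral M (\<lambda>\<omega>. hop R n \<omega> ^ k) (fact k / lam ^ k)"
  using has_bochner_integral_erlang_ith_moment[OF rates(1) distributed_hop, of n k] by simp

lemma service_mean: "n \<noteq> 0 \<Longrightarrow> has_bochner_integral M (service R n) (1 / \<mu>)"
  using has_bochner_integral_erlang_ith_moment[OF rates(2) distributed_service, of n 1] by simp

lemma indep_var_source_pair:
  assumes "s \<in> sources" "t \<in> sources" "s \<noteq> t" "f \<in> borel_measurable borel" "g \<in> borel_measurable borel"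
  shows "indep_var borel (\<lambda>\<omega>. f (source_var R s \<omega>)) borel (\<lambda>\<omega>. g (source_var R t \<omega>))"
proof -
  have "indep_var borel (\<lambda>\<omega>. f (extend_sources {s} (\<lambda>u\<in>{s}. source_var R u \<omega>) s))
      borel (\<lambda>\<omega>. g (extend_sources {t} (\<lambda>u\<in>{t}. source_var R u \<omega>) t))"
    by (rule indep_var_sources[where f = "\<lambda>x. f (x s)" and g = "\<lambda>x. g (x t)"])
      (use assms in \<open>auto intro!: measurable_compose[OF measurable_component_singleton]\<close>)
  then show ?thesis
    using assms by (simp add: extend_sources_def)
qed

lemma hop_times_hop_squared:
  assumes "j \<noteq> 0" "l \<noteq> 0" "j \<noteq> l"
  shows "has_bochner_integral M (\<lambda>\<omega>. hop R j \<omega> * (hop R l \<omega>)\<^sup>2) (1 / lam * (2 / lam\<^sup>2))"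
proof (rule has_bochner_integral_indep_mult)
  show "indep_var borel (hop R j) borel (\<lambda>\<omega>. (hop R l \<omega>)\<^sup>2)"
    using indep_var_source_pair[of "Hop j" "Hop l" "\<lambda>x. x" "\<lambda>x. x\<^sup>2"] assms by simp
  show "has_bochner_integral M (hop R j) (1 / lam)"
    using hop_moment[of j 1] assms by simp
  show "has_bochner_integral M (\<lambda>\<omega>. (hop R l \<omega>)\<^sup>2) (2 / lam\<^sup>2)"
    using hop_moment[of l 2] assms by (simp add: fact_numeral)
qed

lemma hop_squared_times_service:
  assumes "j \<noteq> 0" "n \<noteq> 0"
  shows "has_bochner_integral M (\<lambda>\<omega>. (hop R j \<omega>)\<^sup>2 * service R n \<omega>) (2 / lam\<^sup>2 * (1 / \<mu>))"
proof (rule has_bochner_integral_indep_mult)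
  show "indep_var borel (\<lambda>\<omega>. (hop R j \<omega>)\<^sup>2) borel (service R n)"
    unfolding source_var.simps(2,4)[symmetric]
    by (rule indep_var_source_pair) (use assms in auto)
  show "has_bochner_integral M (\<lambda>\<omega>. (hop R j \<omega>)\<^sup>2) (2 / lam\<^sup>2)"
    using hop_moment[of j 2] assms by (simp add: fact_numeral)
qed (rule service_mean[OF assms(2)])

text \<open>Hop j occurs both in the square and in the waiting time. Averaging over
  \<open>initial_time\<close> with all hops frozen leaves 1/\<theta> times a product over the hops:
  hop j contributes \<open>2 * lam / (lam + \<theta>) ^ 3\<close>, each of the other n-1 hops
  \<open>lam / (lam + \<theta>)\<close>.\<close>

lemma hop_squared_times_waiting_time:
  assumes \<theta>: "0 < \<theta>" and T: "distr M borel (initial_time R) = exponential_measure \<theta>"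
    and j: "j \<in> {1..n}"
  shows "has_bochner_integral M
    (\<lambda>\<omega>. (hop R j \<omega>)\<^sup>2 * max 0 (initial_time R \<omega> - (\<Sum>k=1..n. hop R k \<omega>)))
    (2 * lam / (\<theta> * (lam + \<theta>) ^ 3) * (lam / (lam + \<theta>)) ^ (n - 1))"
proof (rule has_bochner_integral_nn_integral)
  have [measurable]: "hop R k \<in> borel_measurable M" if "k \<in> {1..n}" for k
    using that by (intro measurable_source) auto
  have [measurable]: "(\<lambda>\<omega>. \<Sum>k=1..n. hop R k \<omega>) \<in> borel_measurable M"
    by (intro borel_measurable_sum) measurable
  show "(\<lambda>\<omega>. (hop R j \<omega>)\<^sup>2 * max 0 (initial_time R \<omega> - (\<Sum>k=1..n. hop R k \<omega>))) \<in> borel_measurable M"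
    using j by measurable
  let ?A = "Hop ` {1..n}"
  let ?f = "\<lambda>(x, y). ennreal ((y (Hop j))\<^sup>2 * max 0 (x Init - (\<Sum>k=1..n. y (Hop k))))"
  have A: "?A \<subseteq> sources" by auto
  have f: "?f \<in> borel_measurable (PiM {Init} (\<lambda>_. borel) \<Otimes>\<^sub>M PiM ?A (\<lambda>_. borel))"
  proof -
    have "(\<lambda>z. \<Sum>k=1..n. snd z (Hop k) :: real) \<in> borel_measurable (PiM {Init} (\<lambda>_. borel :: real measure) \<Otimes>\<^sub>M PiM ?A (\<lambda>_. borel))"
      by (intro borel_measurable_sum measurable_compose[OF measurable_snd measurable_component_singleton]) auto
    moreover have "(\<lambda>z. snd z (Hop j) :: real) \<in> borel_measurable (PiM {Init} (\<lambda>_. borel :: real measure) \<Otimes>\<^sub>M PiM ?A (\<lambda>_. borel))"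
      using j by (intro measurable_compose[OF measurable_snd measurable_component_singleton]) auto
    moreover have "(\<lambda>z. fst z Init :: real) \<in> borel_measurable (PiM {Init} (\<lambda>_. borel) \<Otimes>\<^sub>M PiM ?A (\<lambda>_. borel :: real measure))"
      by (intro measurable_compose[OF measurable_fst measurable_component_singleton]) auto
    ultimately show ?thesis
      unfolding case_prod_beta by measurable
  qed
  let ?X = "\<lambda>\<omega>. \<lambda>s\<in>{Init}. source_var R s \<omega>" and ?Y = "\<lambda>\<omega>. \<lambda>s\<in>?A. source_var R s \<omega>"
  \<comment> \<open>Exponent 2 at j and 0 elsewhere brings all factors of the product into one
    common form.\<close>
  let ?e = "\<lambda>k. if k = j then 2 else 0 :: nat"
  have "(\<integral>\<^sup>+\<omega>. ennreal ((hop R j \<omega>)\<^sup>2 * max 0 (initial_time R \<omega> - (\<Sum>k=1..n. hop R k \<omega>))) \<partial>M)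
      = (\<integral>\<^sup>+\<omega>. ?f (?X \<omega>, ?Y \<omega>) \<partial>M)"
    using j by (intro nn_integral_cong) simp
  also have "\<dots> = (\<integral>\<^sup>+\<omega>'. (\<integral>\<^sup>+\<omega>. ?f (?X \<omega>, ?Y \<omega>') \<partial>M) \<partial>M)"
    by (rule nn_integral_indep_var[OF indep_var_restrict[OF indep_sources] f]) (use A in auto)
  also have "\<dots> = (\<integral>\<^sup>+\<omega>. ennreal (1 / \<theta>) * (\<Prod>k\<in>{1..n}. ennreal (hop R k \<omega> ^ ?e k * exp (- \<theta> * hop R k \<omega>))) \<partial>M)"
  proof (rule nn_integral_cong_AE)
    show "AE \<omega>' in M. (\<integral>\<^sup>+\<omega>. ?f (?X \<omega>, ?Y \<omega>') \<partial>M)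
      = ennreal (1 / \<theta>) * (\<Prod>k\<in>{1..n}. ennreal (hop R k \<omega>' ^ ?e k * exp (- \<theta> * hop R k \<omega>')))"
      using AE_hop_nonneg
    proof eventually_elim
      fix \<omega>' assume nonneg: "\<forall>n. n \<noteq> 0 \<longrightarrow> 0 \<le> hop R n \<omega>'"
      define x where "x = (\<Sum>k=1..n. hop R k \<omega>')"
      \<comment> \<open>The excess formula holds for nonnegative thresholds, so hops are restricted
        to the almost sure event where they are nonnegative.\<close>
      have "0 \<le> x" unfolding x_def using nonneg by (intro sum_nonneg) auto
      have "(\<integral>\<^sup>+\<omega>. ?f (?X \<omega>, ?Y \<omega>') \<partial>M)
          = (\<integral>\<^sup>+\<omega>. ennreal ((hop R j \<omega>')\<^sup>2) * ennreal (max 0 (initial_time R \<omega> - x)) \<partial>M)"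
        using j by (intro nn_integral_cong) (simp add: x_def ennreal_mult')
      also have "\<dots> = ennreal ((hop R j \<omega>')\<^sup>2) * (\<integral>\<^sup>+t. ennreal (max 0 (t - x)) \<partial>distr M borel (initial_time R))"
        by (subst nn_integral_cmult) (auto simp: nn_integral_distr)
      also have "\<dots> = ennreal ((hop R j \<omega>')\<^sup>2) * ennreal (exp (- \<theta> * x) / \<theta>)"
        unfolding T nn_integral_exponential_excess[OF \<theta> \<open>0 \<le> x\<close>] ..
      also have "\<dots> = ennreal (1 / \<theta> * ((hop R j \<omega>')\<^sup>2 * exp (- \<theta> * x)))"
        using \<theta> by (simp add: ennreal_mult'[symmetric])
      also have "(hop R j \<omega>')\<^sup>2 * exp (- \<theta> * x)
          = (\<Prod>k\<in>{1..n}. hop R k \<omega>' ^ ?e k * exp (- \<theta> * hop R k \<omega>'))"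
      proof -
        have "(\<Prod>k\<in>{1..n}. hop R k \<omega>' ^ ?e k) = (\<Prod>k\<in>{1..n}. if k = j then (hop R k \<omega>')\<^sup>2 else 1)"
          by (intro prod.cong) auto
        then have "(\<Prod>k\<in>{1..n}. hop R k \<omega>' ^ ?e k) = (hop R j \<omega>')\<^sup>2"
          using j by simp
        moreover have "exp (- \<theta> * x) = (\<Prod>k\<in>{1..n}. exp (- \<theta> * hop R k \<omega>'))"
          by (simp add: x_def sum_distrib_left exp_sum sum_negf[symmetric])
        ultimately show ?thesis by (simp add: prod.distrib)
      qed
      also have "ennreal (1 / \<theta> * (\<Prod>k\<in>{1..n}. hop R k \<omega>' ^ ?e k * exp (- \<theta> * hop R k \<omega>')))
          = ennreal (1 / \<theta>) * (\<Prod>k\<in>{1..n}. ennreal (hop R k \<omega>' ^ ?e k * exp (- \<theta> * hop R k \<omega>')))"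
      proof -
        have "(\<Prod>k\<in>{1..n}. ennreal (hop R k \<omega>' ^ ?e k * exp (- \<theta> * hop R k \<omega>')))
          = ennreal (\<Prod>k\<in>{1..n}. hop R k \<omega>' ^ ?e k * exp (- \<theta> * hop R k \<omega>'))"
          using nonneg by (intro prod_ennreal) auto
        then show ?thesis
          using \<theta> by (simp only:) (rule ennreal_mult', simp)
      qed
      finally show "(\<integral>\<^sup>+\<omega>. ?f (?X \<omega>, ?Y \<omega>') \<partial>M)
          = ennreal (1 / \<theta>) * (\<Prod>k\<in>{1..n}. ennreal (hop R k \<omega>' ^ ?e k * exp (- \<theta> * hop R k \<omega>')))" .
    qed
  qed
  also have "\<dots> = ennreal (1 / \<theta>) * (\<integral>\<^sup>+\<omega>. (\<Prod>k\<in>{1..n}. ennreal (hop R k \<omega> ^ ?e k * exp (- \<theta> * hop R k \<omega>))) \<partial>M)"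
    by (rule nn_integral_cmult, rule borel_measurable_prod_ennreal) measurable
  also have "(\<integral>\<^sup>+\<omega>. (\<Prod>k\<in>{1..n}. ennreal (hop R k \<omega> ^ ?e k * exp (- \<theta> * hop R k \<omega>))) \<partial>M)
      = (\<Prod>k\<in>{1..n}. \<integral>\<^sup>+\<omega>. ennreal (hop R k \<omega> ^ ?e k * exp (- \<theta> * hop R k \<omega>)) \<partial>M)"
  proof (rule indep_vars_nn_integral)
    have "indep_vars (\<lambda>_. borel) (\<lambda>k \<omega>. (\<lambda>y. ennreal (y ^ ?e k * exp (- \<theta> * y))) (hop R k \<omega>)) {1..n}"
      by (rule indep_vars_compose2[OF indep_hops]) auto
    then show "indep_vars (\<lambda>_. borel) (\<lambda>k \<omega>. ennreal (hop R k \<omega> ^ ?e k * exp (- \<theta> * hop R k \<omega>))) {1..n}"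
      by simp
  qed auto
  also have "\<dots> = (\<Prod>k\<in>{1..n}. ennreal (lam / (lam + \<theta>) * (fact (?e k) / (lam + \<theta>) ^ ?e k)))"
    using \<theta> rates(1)
    by (intro prod.cong refl nn_integral_exponential_power_times_exp distributed_hop) auto
  also have "\<dots> = ennreal (\<Prod>k\<in>{1..n}. lam / (lam + \<theta>) * (fact (?e k) / (lam + \<theta>) ^ ?e k))"
    using \<theta> rates(1) by (intro prod_ennreal) auto
  also have "(\<Prod>k\<in>{1..n}. lam / (lam + \<theta>) * (fact (?e k) / (lam + \<theta>) ^ ?e k))
      = (lam / (lam + \<theta>)) ^ n * (2 / (lam + \<theta>)\<^sup>2)"
  proof -
    have "(\<Prod>k\<in>{1..n}. fact (?e k) / (lam + \<theta>) ^ ?e k) = (\<Prod>k\<in>{1..n}. if k = j then 2 / (lam + \<theta>)\<^sup>2 else 1)"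
      by (intro prod.cong) (auto simp: fact_numeral)
    then show ?thesis
      unfolding prod.distrib by (simp only:) (use j in simp)
  qed
  also have "ennreal (1 / \<theta>) * ennreal ((lam / (lam + \<theta>)) ^ n * (2 / (lam + \<theta>)\<^sup>2))
      = ennreal (1 / \<theta> * ((lam / (lam + \<theta>)) ^ n * (2 / (lam + \<theta>)\<^sup>2)))"
    using \<theta> by (simp add: ennreal_mult'[symmetric])
  \<comment> \<open>One of the n factors is absorbed into the cube; n is positive because j lies in
    {1..n}.\<close>
  also have "1 / \<theta> * ((lam / (lam + \<theta>)) ^ n * (2 / (lam + \<theta>)\<^sup>2))
      = 2 * lam / (\<theta> * (lam + \<theta>) ^ 3) * (lam / (lam + \<theta>)) ^ (n - 1)"
    using j by (cases n) (auto simp: power2_eq_square power3_eq_cube mult_ac)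
  finally show "(\<integral>\<^sup>+\<omega>. ennreal ((hop R j \<omega>)\<^sup>2 * max 0 (initial_time R \<omega> - (\<Sum>k=1..n. hop R k \<omega>))) \<partial>M)
      = ennreal (2 * lam / (\<theta> * (lam + \<theta>) ^ 3) * (lam / (lam + \<theta>)) ^ (n - 1))" .
qed (use \<theta> rates in auto)

section \<open>Expected cost of a polling interval\<close>

definition cycle_cost :: "real \<Rightarrow> nat \<Rightarrow> (source \<Rightarrow> real) \<Rightarrow> real" where
  "cycle_cost v n x =
     (\<Sum>j=1..n. v\<^sup>2 / 3 * x (Hop j) ^ 3)
   + (\<Sum>j=1..n. x (Hop j) * (\<Sum>l=1..j - 1. v\<^sup>2 * (x (Hop l))\<^sup>2))
   + (\<Sum>j=1..n. v\<^sup>2 * (x (Hop j))\<^sup>2) * (max 0 (x Init - (\<Sum>j=1..n. x (Hop j))) + x (Serv (Suc 0)))"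

lemma durations_simps [simp]:
  "n \<noteq> 0 \<Longrightarrow> durations \<omega> (Hop n) = hop R n \<omega>"
  "n \<noteq> 0 \<Longrightarrow> durations \<omega> (Serv n) = service R n \<omega>"
  "durations \<omega> Init = initial_time R \<omega>"
  by (auto simp: durations_def duration_sources_def)

text \<open>\<open>cycle_cost\<close> is the contribution with the number of hops held fixed; it
  reads no poll, which is the form required for conditioning on k.\<close>

lemma first_Q: "Q R v (Suc 0) \<omega> = cycle_cost v (hop_count R (Suc 0) \<omega>) (durations \<omega>)"
  by (simp add: Q_def G1_def G2_def G3_def H_def cycle_cost_def first_interarrival hop_duration_def)

lemma measurable_cycle_cost:
  "cycle_cost v n \<in> borel_measurable (PiM duration_sources (\<lambda>_. borel))"
proof -
  have "Init \<in> duration_sources" "Serv (Suc 0) \<in> duration_sources"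
    "j \<in> A \<Longrightarrow> 0 \<notin> A \<Longrightarrow> Hop j \<in> duration_sources" for j A
    by (auto simp: duration_sources_def intro: gr0I)
  note mem = this
  show ?thesis
    unfolding cycle_cost_def
    by (intro borel_measurable_add borel_measurable_times borel_measurable_sum borel_measurable_power
        borel_measurable_max borel_measurable_diff borel_measurable_const measurable_component_singleton mem)
      auto
qed

text \<open>One null set serves all n, since the bound is later evaluated at the random number of
  hops.\<close>

lemma cycle_cost_nonneg: "AE \<omega> in M. \<forall>n. 0 \<le> cycle_cost v n (durations \<omega>)"
  using AE_hop_nonneg AE_service_nonneg[OF nat.distinct(2)[of 0]]
proof eventually_elim
  fix \<omega> assume *: "\<forall>n. n \<noteq> 0 \<longrightarrow> 0 \<le> hop R n \<omega>" "0 \<le> service R (Suc 0) \<omega>"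
  show "\<forall>n. 0 \<le> cycle_cost v n (durations \<omega>)"
    unfolding cycle_cost_def
    using * by (auto intro!: add_nonneg_nonneg mult_nonneg_nonneg sum_nonneg)
qed

text \<open>The summands come from \<open>G1\<close>, from \<open>G2\<close>, and from the service
  and waiting parts of \<open>G3\<close>. The first two share a constant by coincidence of moments:
  E Y^3 / 3 and E Y * E Y^2 both equal \<open>2 / lam ^ 3\<close>.\<close>

lemma has_bochner_integral_cycle_cost:
  assumes \<theta>: "0 < \<theta>" and T: "distr M borel (initial_time R) = exponential_measure \<theta>"
  shows "has_bochner_integral M (\<lambda>\<omega>. cycle_cost v (Suc n) (durations \<omega>))
    (2 * v\<^sup>2 / lam ^ 3 * real (Suc n)
     + 2 * v\<^sup>2 / lam ^ 3 * (real (Suc n) * real n / 2)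
     + 2 * v\<^sup>2 / (lam\<^sup>2 * \<mu>) * real (Suc n)
     + 2 * v\<^sup>2 * lam / (\<theta> * (lam + \<theta>) ^ 3) * (real (Suc n) * (lam / (lam + \<theta>)) ^ n))"
proof -
  let ?N = "Suc n" and ?w = "2 * lam / (\<theta> * (lam + \<theta>) ^ 3) * (lam / (lam + \<theta>)) ^ n"
  have 1: "has_bochner_integral M (\<lambda>\<omega>. \<Sum>j=1..?N. v\<^sup>2 / 3 * hop R j \<omega> ^ 3)
      (\<Sum>j=1..?N. v\<^sup>2 / 3 * (fact 3 / lam ^ 3))"
    by (intro has_bochner_integral_sum has_bochner_integral_mult_right hop_moment) auto
  have 2: "has_bochner_integral M (\<lambda>\<omega>. \<Sum>j=1..?N. \<Sum>l=1..j - 1. v\<^sup>2 * (hop R j \<omega> * (hop R l \<omega>)\<^sup>2))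
      (\<Sum>j=1..?N. \<Sum>l=1..j - 1. v\<^sup>2 * (1 / lam * (2 / lam\<^sup>2)))"
    by (intro has_bochner_integral_sum has_bochner_integral_mult_right hop_times_hop_squared) auto
  have 3: "has_bochner_integral M (\<lambda>\<omega>. \<Sum>j=1..?N. v\<^sup>2 * ((hop R j \<omega>)\<^sup>2 * service R (Suc 0) \<omega>))
      (\<Sum>j=1..?N. v\<^sup>2 * (2 / lam\<^sup>2 * (1 / \<mu>)))"
    by (intro has_bochner_integral_sum has_bochner_integral_mult_right hop_squared_times_service) auto
  have 4: "has_bochner_integral M (\<lambda>\<omega>. \<Sum>j=1..?N. v\<^sup>2 * ((hop R j \<omega>)\<^sup>2
        * max 0 (initial_time R \<omega> - (\<Sum>k=1..?N. hop R k \<omega>))))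
      (\<Sum>j=1..?N. v\<^sup>2 * ?w)"
    using hop_squared_times_waiting_time[OF \<theta> T, of _ ?N]
    by (intro has_bochner_integral_sum has_bochner_integral_mult_right) auto
  \<comment> \<open>\<open>G3\<close> is split into service and waiting, and products are
    distributed over sums, until each summand is one of the known moments.\<close>
  have cost: "cycle_cost v ?N (durations \<omega>)
      = (\<Sum>j=1..?N. v\<^sup>2 / 3 * hop R j \<omega> ^ 3)
      + (\<Sum>j=1..?N. \<Sum>l=1..j - 1. v\<^sup>2 * (hop R j \<omega> * (hop R l \<omega>)\<^sup>2))
      + (\<Sum>j=1..?N. v\<^sup>2 * ((hop R j \<omega>)\<^sup>2 * service R (Suc 0) \<omega>))
      + (\<Sum>j=1..?N. v\<^sup>2 * ((hop R j \<omega>)\<^sup>2 * max 0 (initial_time R \<omega> - (\<Sum>k=1..?N. hop R k \<omega>))))" for \<omega>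
  proof -
    have d: "(\<Sum>j=1..m. g j (durations \<omega> (Hop j))) = (\<Sum>j=1..m. g j (hop R j \<omega>))" for m and g :: "nat \<Rightarrow> real \<Rightarrow> real"
      by (intro sum.cong) auto
    have "cycle_cost v ?N (durations \<omega>)
      = (\<Sum>j=1..?N. v\<^sup>2 / 3 * hop R j \<omega> ^ 3)
      + (\<Sum>j=1..?N. hop R j \<omega> * (\<Sum>l=1..j - 1. v\<^sup>2 * (hop R l \<omega>)\<^sup>2))
      + (\<Sum>j=1..?N. v\<^sup>2 * (hop R j \<omega>)\<^sup>2) * (max 0 (initial_time R \<omega> - (\<Sum>j=1..?N. hop R j \<omega>)) + service R (Suc 0) \<omega>)"
      unfolding cycle_cost_def d[of "\<lambda>_ y. v\<^sup>2 / 3 * y ^ 3"] d[of "\<lambda>_ y. v\<^sup>2 * y\<^sup>2"] d[of "\<lambda>_ y. y"]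
        d[of "\<lambda>j y. y * (\<Sum>l=1..j - 1. v\<^sup>2 * (hop R l \<omega>)\<^sup>2)"]
      by simp
    moreover have "S1 * (W + S) = (\<Sum>j=1..?N. v\<^sup>2 * ((hop R j \<omega>)\<^sup>2 * S)) + (\<Sum>j=1..?N. v\<^sup>2 * ((hop R j \<omega>)\<^sup>2 * W))"
      if "S1 = (\<Sum>j=1..?N. v\<^sup>2 * (hop R j \<omega>)\<^sup>2)" for S1 W S
      unfolding that distrib_left sum_distrib_right by (simp only: mult.assoc add.commute)
    moreover have "(\<Sum>j=1..?N. hop R j \<omega> * (\<Sum>l=1..j - 1. v\<^sup>2 * (hop R l \<omega>)\<^sup>2))
        = (\<Sum>j=1..?N. \<Sum>l=1..j - 1. v\<^sup>2 * (hop R j \<omega> * (hop R l \<omega>)\<^sup>2))"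
      unfolding sum_distrib_left by (simp only: mult.left_commute)
    ultimately show ?thesis by (simp only: add.assoc)
  qed
  have pairs: "(\<Sum>j=1..?N. real (j - 1)) = real ?N * real n / 2"
    by (induction n) (simp_all add: field_simps)
  have "has_bochner_integral M (\<lambda>\<omega>. cycle_cost v ?N (durations \<omega>))
     ((\<Sum>j=1..?N. v\<^sup>2 / 3 * (fact 3 / lam ^ 3))
     + (\<Sum>j=1..?N. \<Sum>l=1..j - 1. v\<^sup>2 * (1 / lam * (2 / lam\<^sup>2)))
     + (\<Sum>j=1..?N. v\<^sup>2 * (2 / lam\<^sup>2 * (1 / \<mu>)))
     + (\<Sum>j=1..?N. v\<^sup>2 * ?w))"
    unfolding cost by (intro has_bochner_integral_add 1 2 3 4)
  moreover have "(\<Sum>j=1..?N. v\<^sup>2 / 3 * (fact 3 / lam ^ 3)) = 2 * v\<^sup>2 / lam ^ 3 * real (Suc n)"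
    by (simp add: fact_numeral)
  moreover have "(\<Sum>j=1..?N. \<Sum>l=1..j - 1. v\<^sup>2 * (1 / lam * (2 / lam\<^sup>2)))
      = 2 * v\<^sup>2 / lam ^ 3 * (real (Suc n) * real n / 2)"
  proof -
    have "(\<Sum>j=1..?N. \<Sum>l=1..j - 1. v\<^sup>2 * (1 / lam * (2 / lam\<^sup>2)))
        = (\<Sum>j=1..?N. real (j - 1)) * (2 * v\<^sup>2 / lam ^ 3)"
      unfolding sum_distrib_right
      by (intro sum.cong) (simp_all add: power2_eq_square power3_eq_cube mult_ac)
    then show ?thesis unfolding pairs by simp
  qed
  moreover have "(\<Sum>j=1..?N. v\<^sup>2 * (2 / lam\<^sup>2 * (1 / \<mu>))) = 2 * v\<^sup>2 / (lam\<^sup>2 * \<mu>) * real (Suc n)"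
    by simp
  moreover have "(\<Sum>j=1..?N. v\<^sup>2 * ?w)
      = 2 * v\<^sup>2 * lam / (\<theta> * (lam + \<theta>) ^ 3) * (real (Suc n) * (lam / (lam + \<theta>)) ^ n)"
    by simp
  ultimately show ?thesis by (simp only:)
qed

text \<open>Geometric weights turn the cost of n+1 hops into derivatives of geometric series at 1-p,
  and at a(1-p) for the waiting term, where a is the tilting factor of one hop.\<close>

lemma expectation_first_Q:
  assumes \<theta>: "0 < \<theta>" and T: "distr M borel (initial_time R) = exponential_measure \<theta>"
  defines "a \<equiv> lam / (lam + \<theta>)"
  shows "expectation (Q R v (Suc 0)) =
     2 * v\<^sup>2 / lam ^ 3 * (1 / p) + 2 * v\<^sup>2 / lam ^ 3 * ((1 - p) / p\<^sup>2) + 2 * v\<^sup>2 / (lam\<^sup>2 * \<mu>) * (1 / p)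
     + 2 * v\<^sup>2 * lam / (\<theta> * (lam + \<theta>) ^ 3) * (p / (1 - a * (1 - p))\<^sup>2)"
    (is "_ = ?E")
proof -
  let ?c1 = "2 * v\<^sup>2 / lam ^ 3" and ?c2 = "2 * v\<^sup>2 / (lam\<^sup>2 * \<mu>)"
    and ?c3 = "2 * v\<^sup>2 * lam / (\<theta> * (lam + \<theta>) ^ 3)"
  let ?m = "\<lambda>n. ?c1 * real (Suc n) + ?c1 * (real (Suc n) * real n / 2) + ?c2 * real (Suc n)
     + ?c3 * (real (Suc n) * a ^ n)"
  have a: "0 < a" "a < 1"
    using \<theta> rates by (simp_all add: a_def)
  have m_nonneg: "0 \<le> ?m n" for n
    using a \<theta> rates by simp
  have "(\<lambda>n. ?c1 * (p * (real (Suc n) * (1 - p) ^ n)) + ?c1 * (p * (real (Suc n) * real n / 2 * (1 - p) ^ n))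
      + ?c2 * (p * (real (Suc n) * (1 - p) ^ n)) + ?c3 * (p * (real (Suc n) * (a * (1 - p)) ^ n)))
    sums (?c1 * (p * (1 / (1 - (1 - p))\<^sup>2)) + ?c1 * (p * ((1 - p) / (1 - (1 - p)) ^ 3))
      + ?c2 * (p * (1 / (1 - (1 - p))\<^sup>2)) + ?c3 * (p * (1 / (1 - a * (1 - p))\<^sup>2)))"
  proof (intro sums_add sums_mult)
    have z: "\<bar>1 - p\<bar> < 1" using polling_prob by auto
    have "a * \<bar>1 - p\<bar> < 1 * 1"
      using a z by (intro mult_strict_mono) auto
    then have az: "\<bar>a * (1 - p)\<bar> < 1"
      using a by (simp add: abs_mult)
    show "(\<lambda>n. real (Suc n) * (1 - p) ^ n) sums (1 / (1 - (1 - p))\<^sup>2)"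
      using geometric_deriv_sums[of "1 - p"] z by simp
    \<comment> \<open>The same series occurs in the \<open>G1\<close> term and in the service term,
      which yields two identical goals.\<close>
    then show "(\<lambda>n. real (Suc n) * (1 - p) ^ n) sums (1 / (1 - (1 - p))\<^sup>2)" .
    show "(\<lambda>n. real (Suc n) * (a * (1 - p)) ^ n) sums (1 / (1 - a * (1 - p))\<^sup>2)"
      using geometric_deriv_sums[of "a * (1 - p)"] az by simp
    show "(\<lambda>n. real (Suc n) * real n / 2 * (1 - p) ^ n) sums ((1 - p) / (1 - (1 - p)) ^ 3)"
      by (rule geometric_second_deriv_sums[OF z])
  qed
  moreover have "?c1 * (p * (real (Suc n) * (1 - p) ^ n)) + ?c1 * (p * (real (Suc n) * real n / 2 * (1 - p) ^ n))
      + ?c2 * (p * (real (Suc n) * (1 - p) ^ n)) + ?c3 * (p * (real (Suc n) * (a * (1 - p)) ^ n))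
      = p * (1 - p) ^ n * ?m n" for n
    unfolding power_mult_distrib by algebra
  moreover have "?c1 * (p * (1 / (1 - (1 - p))\<^sup>2)) + ?c1 * (p * ((1 - p) / (1 - (1 - p)) ^ 3))
      + ?c2 * (p * (1 / (1 - (1 - p))\<^sup>2)) + ?c3 * (p * (1 / (1 - a * (1 - p))\<^sup>2)) = ?E"
  proof -
    have "p * (1 / (1 - (1 - p))\<^sup>2) = 1 / p" "p * ((1 - p) / (1 - (1 - p)) ^ 3) = (1 - p) / p\<^sup>2"
      using polling_prob by (simp_all add: power2_eq_square power3_eq_cube)
    then show ?thesis by simp
  qed
  ultimately have sums: "(\<lambda>n. p * (1 - p) ^ n * ?m n) sums ?E"
    by (simp only:)
  have "(\<integral>\<^sup>+\<omega>. ennreal (Q R v (Suc 0) \<omega>) \<partial>M)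
      = (\<Sum>n. ennreal (p * (1 - p) ^ n) * (\<integral>\<^sup>+\<omega>. ennreal (cycle_cost v (Suc n) (durations \<omega>)) \<partial>M))"
    unfolding first_Q
    by (rule nn_integral_first_hop_count[where f = "\<lambda>n x. ennreal (cycle_cost v n x)"])
      (rule measurable_compose[OF measurable_cycle_cost measurable_ennreal])
  also have "\<dots> = (\<Sum>n. ennreal (p * (1 - p) ^ n * ?m n))"
  proof (intro arg_cong[where f = suminf] ext)
    fix n
    have "has_bochner_integral M (\<lambda>\<omega>. cycle_cost v (Suc n) (durations \<omega>)) (?m n)"
      unfolding a_def by (rule has_bochner_integral_cycle_cost[OF \<theta> T])
    moreover have "AE \<omega> in M. 0 \<le> cycle_cost v (Suc n) (durations \<omega>)"
      using cycle_cost_nonneg[of v] by eventually_elim auto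
    ultimately have "(\<integral>\<^sup>+\<omega>. ennreal (cycle_cost v (Suc n) (durations \<omega>)) \<partial>M) = ennreal (?m n)"
      by (subst nn_integral_eq_integral) (auto simp: has_bochner_integral_iff)
    then show "ennreal (p * (1 - p) ^ n) * (\<integral>\<^sup>+\<omega>. ennreal (cycle_cost v (Suc n) (durations \<omega>)) \<partial>M)
        = ennreal (p * (1 - p) ^ n * ?m n)"
      using polling_prob by (simp only:) (rule ennreal_mult'[symmetric], simp)
  qed
  also have "\<dots> = ennreal ?E"
    using polling_prob m_nonneg by (intro suminf_ennreal_eq sums mult_nonneg_nonneg) auto
  finally have nn: "(\<integral>\<^sup>+\<omega>. ennreal (Q R v (Suc 0) \<omega>) \<partial>M) = ennreal ?E" .
  \<comment> \<open>A nonnegative finite value turns the nonnegative integral into a Bochner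
    integral, and so establishes integrability of \<open>Q\<close>.\<close>
  have "0 \<le> ?E"
    using sums polling_prob m_nonneg
    by (intro sums_le[OF _ sums_zero sums] mult_nonneg_nonneg) auto
  moreover have "AE \<omega> in M. 0 \<le> Q R v (Suc 0) \<omega>"
    using cycle_cost_nonneg[of v] by eventually_elim (simp add: first_Q)
  ultimately have "has_bochner_integral M (Q R v (Suc 0)) ?E"
    using nn by (intro has_bochner_integral_nn_integral) auto
  then show ?thesis by (rule has_bochner_integral_integral_eq)
qed

end

theorem theorem1:
  fixes M :: "'a measure" and R :: "'a waypoint_queue"
    and v lam \<mu> p \<rho> \<rho>\<^sub>e :: real and mode :: positioning_mode and i :: nat
  assumes "v > 0" and "lam > 0" and "\<mu> > 0" and "0 < p" and "p \<le> 1"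
    and "\<rho> = p * lam / \<mu>" and "\<rho> < 1"
    and "\<rho>\<^sub>e = lam / (\<mu> * (1 - \<rho>) + lam)"
    and "MM1_waypoint_queue M lam \<mu> p R"
    and "steady_state M R"
    and "i \<ge> 1"
  shows "AoP M R v lam p mode i = p * kappa mode * lam * (\<integral>\<omega>. Q R v i \<omega> \<partial>M)
    \<and> (\<integral>\<omega>. Q R v i \<omega> \<partial>M) =
        2 * v\<^sup>2 * ((1 - p) / (p\<^sup>2 * lam ^ 3))
        + 2 * v\<^sup>2 / (p * lam ^ 3)
        + 2 * v\<^sup>2 / (p * lam\<^sup>2 * \<mu>)
        + 2 * v\<^sup>2 * p * \<rho>\<^sub>e / (\<mu> * (1 - \<rho>))
          * (1 / ((\<mu> * (1 - \<rho>) + lam)\<^sup>2 * (1 - \<rho>\<^sub>e * (1 - p))\<^sup>2))"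
proof -
  interpret prob_space M
    using assms(9) by (simp add: MM1_waypoint_queue_def)
  interpret mm1_waypoint_queue M lam \<mu> p R
    by unfold_locales fact+
  define \<theta> where "\<theta> = \<mu> * (1 - \<rho>)"
  have \<theta>: "0 < \<theta>" "\<theta> = \<mu> - p * lam"
    using assms(3,6,7) by (simp_all add: \<theta>_def right_diff_distrib)
  have "p * lam < \<mu>"
    using \<theta> by simp
  then have T: "distr M borel (initial_time R) = exponential_measure \<theta>"
    unfolding \<theta>(2) using assms(10) by (rule distr_initial_time)
  obtain k where "i = Suc k"
    using assms(11) by (cases i) auto
  then have "expectation (Q R v i) = expectation (Q R v (Suc 0))"
    using expectation_Q_stationary[OF assms(10)] by simp
  also have "\<dots> = 2 * v\<^sup>2 / lam ^ 3 * (1 / p) + 2 * v\<^sup>2 / lam ^ 3 * ((1 - p) / p\<^sup>2) + 2 * v\<^sup>2 / (lam\<^sup>2 * \<mu>) * (1 / p)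
     + 2 * v\<^sup>2 * lam / (\<theta> * (lam + \<theta>) ^ 3) * (p / (1 - lam / (lam + \<theta>) * (1 - p))\<^sup>2)"
    by (rule expectation_first_Q[OF \<theta>(1) T])
  also have "lam / (lam + \<theta>) = \<rho>\<^sub>e"
    unfolding assms(8) \<theta>_def by (simp add: add.commute)
  \<comment> \<open>One factor of the cube combines with \<open>lam\<close> to
    \<open>\<rho>\<^sub>e\<close>, which leaves the square of the stated formula.\<close>
  also have "2 * v\<^sup>2 * lam / (\<theta> * (lam + \<theta>) ^ 3) * (p / (1 - \<rho>\<^sub>e * (1 - p))\<^sup>2)
      = 2 * v\<^sup>2 * p * \<rho>\<^sub>e / \<theta> * (1 / ((\<theta> + lam)\<^sup>2 * (1 - \<rho>\<^sub>e * (1 - p))\<^sup>2))"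
  proof -
    have "\<rho>\<^sub>e = lam / (\<theta> + lam)"
      unfolding assms(8) \<theta>_def ..
    then have "2 * v\<^sup>2 * lam / (\<theta> * (lam + \<theta>) ^ 3) = 2 * v\<^sup>2 * \<rho>\<^sub>e / (\<theta> * (\<theta> + lam)\<^sup>2)"
      by (simp add: power2_eq_square power3_eq_cube add.commute)
    then show ?thesis by (simp only:) (simp add: mult_ac)
  qed
  finally show ?thesis
    unfolding \<theta>_def AoP_def by (simp add: mult_ac)
qed

end
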